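(* Suppose $n$ is an even integer with $t_1+t_2\leq n<t_3$, and put $K=k_1+k_2+k_3$, $N=\tfrac{n+1}{2}$. Then: (i) the $\mathfrak{BI}$-module $\mathscr M_n(x_1)\cap\mathscr M_n(x_2)$ is isomorphic to $W_1\oplus W_1$, where $W_1=O_{n-t_1-t_2}(k_2+k_3+N,\,-k_1-k_3-N,\,-N)^{((-1,1),(1\,2))}$; (ii) the $\mathfrak{BI}$-modules $\mathscr M_n(x_2)/(\mathscr M_n(x_1)\cap\mathscr M_n(x_2))$ and $\mathscr M_n/\mathscr M_n(x_1)$ are each isomorphic to $W_2\oplus W_2$, where $W_2=O_{t_1-1}(k_3,\,-K-n-1,\,-k_2)^{((1,-1),(1\,2))}$; (iii) the $\mathfrak{BI}$-modules $\mathscr M_n(x_1)/(\mathscr M_n(x_1)\cap\mathscr M_n(x_2))$ and $\mathscr M_n/\mathscr M_n(x_2)$ are each isomorphic to $W_3\oplus W_3$, where $W_3=O_{t_2-1}(k_3,\,-K-n-1,\,-k_1)^{(1,-1)}$. Moreover, if $k_3\geq0$, then $W_1,W_2,W_3$ are irreducible and are isomorphic to $O_{n-t_1-t_2}(-k_1-k_3-N,\,-k_2-k_3-N,\,N)$, $O_{t_1-1}(K+n+1,\,k_3,\,k_2)$ and $O_{t_2-1}(k_3,\,K+n+1,\,k_1)$, respectively.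
   Context: Fix real numbers $k_1,k_2,k_3$. For $i=1,2,3$ let $R_i$ be the operator on functions on $\mathbb R^3$ replacing $x_i$ by $-x_i$, and $T_if=\frac{\partial f}{\partial x_i}+k_i\frac{f-R_if}{x_i}$ (Dunkl operators). Let $\sigma_1=\begin{pmatrix}0&1\\1&0\end{pmatrix}$, $\sigma_2=\begin{pmatrix}0&-\sqrt{-1}\\ \sqrt{-1}&0\end{pmatrix}$, $\sigma_3=\begin{pmatrix}1&0\\0&-1\end{pmatrix}$, and let $e_i$ act on $\mathbb C^2$ by $\sigma_i$. Tensor products are over $\mathbb R$; $\mathbb R[\cdots]_m$ denotes homogeneous polynomials of degree $m$. Let $\mathbf D=e_1\otimes T_1+e_2\otimes T_2+e_3\otimes T_3$ and $\mathscr M_n=\ker(\mathbf D|_{\mathbb C^2\otimes\mathbb R[x_1,x_2,x_3]_n})$. For $i=1,2,3$ set $t_i=-2k_i$ if $2k_i$ is an odd negative integer, and $t_i=\infty$ otherwise. For $i=1,2,3$, $\mathscr M_n(x_i)=\mathscr M_n\cap\bigoplus_{j=t_i}^n\mathbb C^2\otimes(x_i^j\cdot\mathbb R[x_p,x_q]_{n-j})$ where $\{p,q\}=\{1,2,3\}\setminus\{i\}$ (it is $\{0\}$ if $n<t_i$); it is a $\mathfrak{BI}$-submodule of $\mathscr M_n$. $\mathfrak{BI}$ is the unital associative $\mathbb C$-algebra generated by $X,Y,Z$ with relations saying that $\{X,Y\}-Z$, $\{Y,Z\}-X$, $\{Z,X\}-Y$ commute with $X,Y,Z$ ($\{A,B\}=AB+BA$).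 $\mathscr M_n$ is a $\mathfrak{BI}$-module via $X=(\sqrt{-1}\,e_1\otimes(x_3T_2-x_2T_3)+\tfrac12)R_2R_3+k_2R_3+k_3R_2$, $Y=(\sqrt{-1}\,e_2\otimes(x_1T_3-x_3T_1)+\tfrac12)R_1R_3+k_3R_1+k_1R_3$, $Z=(\sqrt{-1}\,e_3\otimes(x_2T_1-x_1T_2)+\tfrac12)R_1R_2+k_1R_2+k_2R_1$, operators composed right to left, $R_i$ acting on the polynomial factor. Twisting: for a $\mathfrak{BI}$-module $V$ and algebra automorphism $\varepsilon$, $V^\varepsilon$ is $V$ with action $x\cdot v=\varepsilon(x)v$. A permutation $\sigma\in\mathfrak S_3$ denotes the automorphism sending the generator with index $i$ in $(X,Y,Z)$ to the generator with index $\sigma(i)$; the sign automorphisms are $(1,-1)\colon X\mapsto X,Y\mapsto -Y,Z\mapsto -Z$; $(-1,1)\colon X\mapsto -X,Y\mapsto Y,Z\mapsto -Z$; $(-1,-1)\colon X\mapsto -X,Y\mapsto -Y,Z\mapsto Z$; a pair $(\epsilon,\sigma)$ denotes the composite $\epsilon\circ\sigma$. For $a,b,c\in\mathbb C$ and even $d\geq0$, $O_d(a,b,c)$ is the $\mathfrak{BI}$-module $\mathbb C^{d+1}$ in which, w.r.t. a basis $v_0,\dots,v_d$, $X$ acts by the lower bidiagonal matrix with diagonal $(\theta_0,\dots,\theta_d)$ and subdiagonal entries $1$, $Y$ by the upper bidiagonal matrix with diagonal $(\theta^*_0,\dots,\theta^*_d)$ and superdiagonal $(\varphi_1,\dots,\varphi_d)$,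 and $Z=\{X,Y\}-(2ab-c(d+1))$, where $\theta_i=\frac{(-1)^i(2a-d+2i)}{2}$, $\theta^*_i=\frac{(-1)^i(2b-d+2i)}{2}$, $\varphi_i=\frac{i(d+1-2i-2a-2b-2c)}{2}$ ($i$ even), $\varphi_i=\frac{(i-d-1)(d+1-2i-2a-2b+2c)}{2}$ ($i$ odd). *)

theory Defs
  imports Complex_Main "HOL-Library.Extended_Nat"
begin

definition vzero :: "'i \<Rightarrow> complex" where "vzero = (\<lambda>_. 0)"
definition vadd :: "('i \<Rightarrow> complex) \<Rightarrow> ('i \<Rightarrow> complex) \<Rightarrow> ('i \<Rightarrow> complex)"
  where "vadd f g = (\<lambda>i. f i + g i)"
definition smul :: "complex \<Rightarrow> ('i \<Rightarrow> complex) \<Rightarrow> ('i \<Rightarrow> complex)"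
  where "smul c f = (\<lambda>i. c * f i)"

definition subspace_c :: "('i \<Rightarrow> complex) set \<Rightarrow> bool" where
  "subspace_c S \<longleftrightarrow> vzero \<in> S \<and> (\<forall>x\<in>S. \<forall>y\<in>S. vadd x y \<in> S) \<and> (\<forall>c. \<forall>x\<in>S. smul c x \<in> S)"

definition linear_on :: "('i \<Rightarrow> complex) set \<Rightarrow> (('i \<Rightarrow> complex) \<Rightarrow> ('j \<Rightarrow> complex)) \<Rightarrow> bool" where
  "linear_on S f \<longleftrightarrow> (\<forall>x\<in>S. \<forall>y\<in>S. f (vadd x y) = vadd (f x) (f y)) \<and>
                      (\<forall>c. \<forall>x\<in>S. f (smul c x) = smul c (f x))"

text \<open>A BI-module is given by its carrier (a complex vector space) and the action
of the three generators X, Y, Z (which determine the action of the whole algebra).\<close>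
record 'i bimod =
  car :: "('i \<Rightarrow> complex) set"
  opX :: "('i \<Rightarrow> complex) \<Rightarrow> ('i \<Rightarrow> complex)"
  opY :: "('i \<Rightarrow> complex) \<Rightarrow> ('i \<Rightarrow> complex)"
  opZ :: "('i \<Rightarrow> complex) \<Rightarrow> ('i \<Rightarrow> complex)"

definition intertwines :: "'i bimod \<Rightarrow> 'j bimod \<Rightarrow> ('i \<Rightarrow> complex) set \<Rightarrow> (('i \<Rightarrow> complex) \<Rightarrow> ('j \<Rightarrow> complex)) \<Rightarrow> bool" where
  "intertwines M W S phi \<longleftrightarrow> (\<forall>v\<in>S. phi (opX M v) = opX W (phi v) \<and>
       phi (opY M v) = opY W (phi v) \<and> phi (opZ M v) = opZ W (phi v))"

definition bimod_iso :: "'i bimod \<Rightarrow> 'j bimod \<Rightarrow> bool" where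
  "bimod_iso M W \<longleftrightarrow> (\<exists>phi. linear_on (car M) phi \<and> bij_betw phi (car M) (car W) \<and>
                             intertwines M W (car M) phi)"

text \<open>The quotient module A/B (A, B carriers of submodules of M, with the action of M)
is isomorphic to W: equivalently, there is a surjective module map from A onto W
whose kernel is exactly B (the induced map A/B \<rightarrow> W is then an isomorphism).\<close>
definition bimod_quot_iso :: "'i bimod \<Rightarrow> ('i \<Rightarrow> complex) set \<Rightarrow> ('i \<Rightarrow> complex) set \<Rightarrow> 'j bimod \<Rightarrow> bool" where
  "bimod_quot_iso M A B W \<longleftrightarrow> B \<subseteq> A \<and>
     (\<exists>phi. linear_on A phi \<and> phi ` A = car W \<and> (\<forall>v\<in>A. phi v = vzero \<longleftrightarrow> v \<in> B) \<and>
            intertwines M W A phi)"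

definition bimod_irred :: "'i bimod \<Rightarrow> bool" where
  "bimod_irred W \<longleftrightarrow> car W \<noteq> {vzero} \<and>
     (\<forall>S. S \<subseteq> car W \<and> subspace_c S \<and> (\<forall>v\<in>S. opX W v \<in> S \<and> opY W v \<in> S \<and> opZ W v \<in> S)
          \<longrightarrow> S = {vzero} \<or> S = car W)"

definition dsum :: "'i bimod \<Rightarrow> (bool \<times> 'i) bimod" where
  "dsum W = \<lparr> car = {f. (\<lambda>i. f (True, i)) \<in> car W \<and> (\<lambda>i. f (False, i)) \<in> car W},
              opX = (\<lambda>f (b, i). opX W (\<lambda>j. f (b, j)) i),
              opY = (\<lambda>f (b, i). opY W (\<lambda>j. f (b, j)) i),
              opZ = (\<lambda>f (b, i). opZ W (\<lambda>j. f (b, j)) i) \<rparr>"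

definition gen :: "'i bimod \<Rightarrow> nat \<Rightarrow> ('i \<Rightarrow> complex) \<Rightarrow> ('i \<Rightarrow> complex)" where
  "gen W i = (if i = 1 then opX W else if i = 2 then opY W else opZ W)"

text \<open>Twist by the composite automorphism eps \<circ> sigma, where sigma sends the generator
with index i to the one with index sigma i, and eps multiplies generator j by the sign eps j.\<close>
definition twist :: "(nat \<Rightarrow> complex) \<Rightarrow> (nat \<Rightarrow> nat) \<Rightarrow> 'i bimod \<Rightarrow> 'i bimod" where
  "twist eps sigma W = \<lparr> car = car W,
     opX = (\<lambda>v. smul (eps (sigma 1)) (gen W (sigma 1) v)),
     opY = (\<lambda>v. smul (eps (sigma 2)) (gen W (sigma 2) v)),
     opZ = (\<lambda>v. smul (eps (sigma 3)) (gen W (sigma 3) v)) \<rparr>"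

definition sign_aut :: "complex \<Rightarrow> complex \<Rightarrow> nat \<Rightarrow> complex" where
  "sign_aut a b = (\<lambda>i. if i = 1 then a else if i = 2 then b else a * b)"

definition swap12 :: "nat \<Rightarrow> nat" where
  "swap12 = (\<lambda>i. if i = 1 then 2 else if i = 2 then 1 else i)"

definition Otheta :: "nat \<Rightarrow> complex \<Rightarrow> nat \<Rightarrow> complex" where
  "Otheta d a i = (-1) ^ i * (2 * a - of_nat d + 2 * of_nat i) / 2"

definition Ophi :: "nat \<Rightarrow> complex \<Rightarrow> complex \<Rightarrow> complex \<Rightarrow> nat \<Rightarrow> complex" where
  "Ophi d a b c i = (if even i
      then of_nat i * (of_nat d + 1 - 2 * of_nat i - 2 * a - 2 * b - 2 * c) / 2
      else (of_nat i - of_nat d - 1) * (of_nat d + 1 - 2 * of_nat i - 2 * a - 2 * b + 2 * c) / 2)"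

definition OX :: "nat \<Rightarrow> complex \<Rightarrow> (nat \<Rightarrow> complex) \<Rightarrow> (nat \<Rightarrow> complex)" where
  "OX d a v = (\<lambda>i. if i \<le> d then Otheta d a i * v i + (if 1 \<le> i then v (i - 1) else 0) else 0)"

definition OY :: "nat \<Rightarrow> complex \<Rightarrow> complex \<Rightarrow> complex \<Rightarrow> (nat \<Rightarrow> complex) \<Rightarrow> (nat \<Rightarrow> complex)" where
  "OY d a b c v = (\<lambda>i. if i \<le> d then Otheta d b i * v i +
                          (if i + 1 \<le> d then Ophi d a b c (i + 1) * v (i + 1) else 0) else 0)"

definition Omod :: "nat \<Rightarrow> complex \<Rightarrow> complex \<Rightarrow> complex \<Rightarrow> nat bimod" where
  "Omod d a b c = \<lparr> car = {v. \<forall>i. v i \<noteq> 0 \<longrightarrow> i \<le> d},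
     opX = OX d a, opY = OY d a b c,
     opZ = (\<lambda>v. vadd (vadd (OX d a (OY d a b c v)) (OY d a b c (OX d a v)))
                      (smul (- (2 * a * b - c * (of_nat d + 1))) v)) \<rparr>"

text \<open>An element of C^2 \<otimes>_R R[x1,x2,x3] is encoded by its coefficient function:
f ((a,b,c), s) is the coefficient of the monomial x1^a x2^b x3^c in the s-th
coordinate of C^2 (s \<in> {0,1}).\<close>
type_synonym idx = "(nat \<times> nat \<times> nat) \<times> nat"

fun ex :: "nat \<Rightarrow> nat \<times> nat \<times> nat \<Rightarrow> nat" where
  "ex i (a, b, c) = (if i = 1 then a else if i = 2 then b else c)"
fun shift :: "nat \<Rightarrow> nat \<times> nat \<times> nat \<Rightarrow> nat \<times> nat \<times> nat" where
  "shift i (a, b, c) = (if i = 1 then (a + 1, b, c) else if i = 2 then (a, b + 1, c) else (a, b, c + 1))"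
fun unshift :: "nat \<Rightarrow> nat \<times> nat \<times> nat \<Rightarrow> nat \<times> nat \<times> nat" where
  "unshift i (a, b, c) = (if i = 1 then (a - 1, b, c) else if i = 2 then (a, b - 1, c) else (a, b, c - 1))"

definition Pn :: "nat \<Rightarrow> (idx \<Rightarrow> complex) set" where
  "Pn n = {f. \<forall>a b c s. f ((a, b, c), s) \<noteq> 0 \<longrightarrow> a + b + c = n \<and> s < 2}"

definition refl_op :: "nat \<Rightarrow> (idx \<Rightarrow> complex) \<Rightarrow> (idx \<Rightarrow> complex)" where
  "refl_op i f = (\<lambda>(m, s). (-1) ^ ex i m * f (m, s))"

definition mulx :: "nat \<Rightarrow> (idx \<Rightarrow> complex) \<Rightarrow> (idx \<Rightarrow> complex)" where
  "mulx i f = (\<lambda>(m, s). if ex i m = 0 then 0 else f (unshift i m, s))"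

text \<open>Dunkl operator T_i; on monomials T_i x_i^a = (a + k_i (1 - (-1)^a)) x_i^(a-1).\<close>
definition dunkl :: "(nat \<Rightarrow> real) \<Rightarrow> nat \<Rightarrow> (idx \<Rightarrow> complex) \<Rightarrow> (idx \<Rightarrow> complex)" where
  "dunkl k i f = (\<lambda>(m, s). (of_nat (ex i m + 1) + of_real (k i) * (1 - (-1) ^ (ex i m + 1)))
                              * f (shift i m, s))"

definition pauli :: "nat \<Rightarrow> nat \<Rightarrow> nat \<Rightarrow> complex" where
  "pauli i s t =
     (if i = 1 then (if (s = 0 \<and> t = 1) \<or> (s = 1 \<and> t = 0) then 1 else 0)
      else if i = 2 then (if s = 0 \<and> t = 1 then - \<i> else if s = 1 \<and> t = 0 then \<i> else 0)
      else (if s = 0 \<and> t = 0 then 1 else if s = 1 \<and> t = 1 then -1 else 0))"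

definition pauli_act :: "nat \<Rightarrow> (idx \<Rightarrow> complex) \<Rightarrow> (idx \<Rightarrow> complex)" where
  "pauli_act i f = (\<lambda>(m, s). \<Sum>t<2. pauli i s t * f (m, t))"

definition dirac :: "(nat \<Rightarrow> real) \<Rightarrow> (idx \<Rightarrow> complex) \<Rightarrow> (idx \<Rightarrow> complex)" where
  "dirac k f = vadd (vadd (pauli_act 1 (dunkl k 1 f)) (pauli_act 2 (dunkl k 2 f)))
                    (pauli_act 3 (dunkl k 3 f))"

definition Mn :: "(nat \<Rightarrow> real) \<Rightarrow> nat \<Rightarrow> (idx \<Rightarrow> complex) set" where
  "Mn k n = {f \<in> Pn n. dirac k f = vzero}"

definition tpar :: "real \<Rightarrow> enat" where
  "tpar r = (if \<exists>j::nat. odd j \<and> 2 * r = - real j then enat (nat (- \<lfloor>2 * r\<rfloor>)) else \<infinity>)"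

definition Mx :: "(nat \<Rightarrow> real) \<Rightarrow> nat \<Rightarrow> nat \<Rightarrow> (idx \<Rightarrow> complex) set" where
  "Mx k n i = {f \<in> Mn k n. \<forall>m s. f (m, s) \<noteq> 0 \<longrightarrow> enat (ex i m) \<ge> tpar (k i)}"

definition Lop :: "(nat \<Rightarrow> real) \<Rightarrow> nat \<Rightarrow> nat \<Rightarrow> (idx \<Rightarrow> complex) \<Rightarrow> (idx \<Rightarrow> complex)" where
  "Lop k p q f = vadd (mulx p (dunkl k q f)) (smul (-1) (mulx q (dunkl k p f)))"

definition Gop :: "(nat \<Rightarrow> real) \<Rightarrow> nat \<Rightarrow> nat \<Rightarrow> nat \<Rightarrow> nat \<Rightarrow> nat \<Rightarrow> (idx \<Rightarrow> complex) \<Rightarrow> (idx \<Rightarrow> complex)" where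
  "Gop k j p q a b f =
     (let g = refl_op a (refl_op b f) in
      vadd (vadd (vadd (smul \<i> (pauli_act j (Lop k p q g))) (smul (1/2) g))
                 (smul (of_real (k a)) (refl_op b f)))
           (smul (of_real (k b)) (refl_op a f)))"

definition Mmod :: "(nat \<Rightarrow> real) \<Rightarrow> nat \<Rightarrow> idx bimod" where
  "Mmod k n = \<lparr> car = Mn k n,
     opX = Gop k 1 3 2 2 3,
     opY = Gop k 2 1 3 1 3,
     opZ = Gop k 3 2 1 1 2 \<rparr>"

end

theory Submission
  imports Defs
begin

text \<open>
  Since \<open>n < t\<^sub>3\<close>, the operator \<open>T\<^sub>3\<close> only divides by non-zero numbers in degree at most \<open>n\<close>, so
  the Dirac equation can be solved recursively in powers of \<open>x\<^sub>3\<close>, and an element of the kernel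
  is an arbitrary initial value on the plane \<open>x\<^sub>3 = 0\<close>. Expressed through initial values, \<open>X\<close>, \<open>Y\<close>
  and \<open>Z\<close> no longer mix the two coordinates of \<open>\<complex>\<^sup>2\<close>, and both coordinates give the same module:
  on the monomials \<open>x\<^sub>1\<^sup>a x\<^sub>2\<^bsup>n-a\<^esup>\<close>, suitably rescaled, \<open>X\<close> and \<open>Y\<close> are real and bidiagonal in opposite
  directions. The coefficient of \<open>X\<close> that links \<open>a = t\<^sub>1\<close> to \<open>a = t\<^sub>1 - 1\<close> and the one of \<open>Y\<close> that links
  \<open>a = n - t\<^sub>2\<close> to \<open>a = n - t\<^sub>2 + 1\<close> vanish; these breaks are the two submodules, and each subquotient
  is a window of consecutive values of \<open>a\<close> on which the bidiagonal matrices are, up to a further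
  rescaling, those of the module \<open>O\<^sub>d\<close>.

  For the second half, let \<open>P\<close> be the chain \<open>(X - \<theta>\<^sub>d) (X - \<theta>\<^bsub>d-1\<^esub>) \<dots> v\<^sub>0\<close>, in which the eigenvalues of \<open>X\<close> are
  used in reverse order. The relation \<open>{X,{X,Y}} = Y + \<mu> + 2\<kappa>X\<close> forces \<open>Y\<close> to be upper bidiagonal
  along \<open>P\<close>, which gives \<open>O\<^sub>d(a,b,c) \<cong> O\<^sub>d(-a,b,-c)\<close> twisted by \<open>X \<mapsto> -X\<close>. Together with the reversal of
  the basis it yields the stated isomorphisms, and it also yields irreducibility as soon as no
  \<open>\<phi>\<^sub>i\<close> vanishes for either set of parameters.
\<close>

section \<open>The relation satisfied by X and Y on the modules O\<close>

definition seqs :: "nat \<Rightarrow> (nat \<Rightarrow> complex) set" where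
  "seqs d = {v. \<forall>i. v i \<noteq> 0 \<longrightarrow> i \<le> d}"

lemma vec_apply: "vadd f g i = f i + g i" "smul c f i = c * f i" "vzero i = 0"
  by (simp_all add: vadd_def smul_def vzero_def)

lemma seqs_outside: "v \<in> seqs d \<Longrightarrow> d < i \<Longrightarrow> v i = 0"
  by (force simp: seqs_def)

lemma subspace_seqs [simp]: "subspace_c (seqs d)"
  by (auto simp: subspace_c_def seqs_def vec_apply) (metis add.left_neutral)

lemma OX_seqs [simp]: "OX d a v \<in> seqs d"
  by (auto simp: seqs_def OX_def)

lemma OY_seqs [simp]: "OY d a b c v \<in> seqs d"
  by (auto simp: seqs_def OY_def)

lemma OX_0: "OX d a v 0 = Otheta d a 0 * v 0"
  by (simp add: OX_def)

lemma OX_Suc: "Suc i \<le> d \<Longrightarrow> OX d a v (Suc i) = Otheta d a (Suc i) * v (Suc i) + v i"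
  by (simp add: OX_def)

text \<open>For even \<open>d\<close> the index \<open>Suc d\<close> is odd, and there
  \<open>Ophi\<close> has the factor \<open>i - d - 1\<close>, which is zero; so the last row needs
  no separate case.\<close>

lemma OY_le:
  assumes "even d" "i \<le> d"
  shows "OY d a b c v i = Otheta d b i * v i + Ophi d a b c (Suc i) * v (Suc i)"
proof (cases "i = d")
  case True
  with assms show ?thesis by (simp add: OY_def Ophi_def)
qed (use assms in \<open>simp add: OY_def\<close>)

lemma OX_vadd: "OX d a (vadd v w) = vadd (OX d a v) (OX d a w)"
  by (auto simp: OX_def fun_eq_iff vec_apply algebra_simps)
lemma OX_smul: "OX d a (smul r v) = smul r (OX d a v)"
  by (auto simp: OX_def fun_eq_iff vec_apply algebra_simps)
lemma OY_vadd: "OY d a b c (vadd v w) = vadd (OY d a b c v) (OY d a b c w)"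
  by (auto simp: OY_def fun_eq_iff vec_apply algebra_simps)
lemma OY_smul: "OY d a b c (smul r v) = smul r (OY d a b c v)"
  by (auto simp: OY_def fun_eq_iff vec_apply algebra_simps)


text \<open>Split by parity, with \<open>d = 2 * e\<close>, the entries become polynomials in
  \<open>e\<close> and \<open>j\<close>, so that identities between matrices reduce to polynomial
  ones.\<close>

lemma Otheta_parity:
  "Otheta (2 * e) a (2 * j) = a - of_nat e + 2 * of_nat j"
  "Otheta (2 * e) a (Suc (2 * j)) = - (a - of_nat e + 2 * of_nat j + 1)"
  by (simp_all add: Otheta_def field_simps)

lemma Ophi_parity:
  "Ophi (2 * e) a b c (2 * j) = of_nat j * (2 * of_nat e + 1 - 4 * of_nat j - 2 * a - 2 * b - 2 * c)"
  "Ophi (2 * e) a b c (Suc (2 * j)) = (of_nat j - of_nat e) * (2 * of_nat e - 1 - 4 * of_nat j - 2 * a - 2 * b + 2 * c)"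
  by (simp_all add: Ophi_def field_simps)

text \<open>The central element \<open>{Z,X} - Y\<close> acts by the scalar \<open>\<mu>\<close>:
  here \<open>Z = {X,Y} - \<kappa>\<close> is inserted and the equation is solved for
  \<open>Y X X\<close>. Only the coordinates \<open>i - 2\<close> to \<open>i + 1\<close> are
  involved, so it comes down to a polynomial identity between matrix entries.\<close>

lemma O_relation:
  fixes a b c :: complex and d :: nat
  defines "X \<equiv> OX d a" and "Y \<equiv> OY d a b c"
    and "\<kappa> \<equiv> 2 * a * b - c * (of_nat d + 1)" and "\<mu> \<equiv> 2 * a * c - b * (of_nat d + 1)"
  assumes d: "even d" and v: "v \<in> seqs d"
  shows "Y (X (X v)) i = Y v i + \<mu> * v i + 2 * \<kappa> * X v i - X (X (Y v)) i - 2 * X (Y (X v)) i"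
proof (cases "i \<le> d")
  case False
  then show ?thesis using seqs_outside[OF v] by (simp add: X_def Y_def OX_def OY_def)
next
  case le: True
  from d obtain e where e: "d = 2 * e" by (elim evenE)
  define \<theta> \<theta>' \<phi> where "\<theta> = Otheta d a" and "\<theta>' = Otheta d b" and "\<phi> = Ophi d a b c"
  \<comment> \<open>Row \<open>Suc i\<close> may lie outside the matrix, but then its coefficient
    \<open>\<phi> (Suc i)\<close> is zero; hence \<open>X\<close> may be expanded there whenever
    that factor stands in front.\<close>
  have last: "\<phi> (Suc i) = 0 \<or> Suc i \<le> d"
    using le e Ophi_parity(2)[of e a b c e] by (cases "i = d") (auto simp: \<phi>_def)
  have Y: "Y w j = \<theta>' j * w j + \<phi> (Suc j) * w (Suc j)" if "j \<le> d" for w j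
    using that d by (simp add: Y_def OY_le \<theta>'_def \<phi>_def)
  have X0: "X w 0 = \<theta> 0 * w 0" for w by (simp add: X_def OX_0 \<theta>_def)
  have XS: "X w (Suc j) = \<theta> (Suc j) * w (Suc j) + w j" if "Suc j \<le> d" for w j
    using that by (simp add: X_def OX_Suc \<theta>_def)
  have YX: "\<phi> (Suc i) * X w (Suc i) = \<phi> (Suc i) * (\<theta> (Suc i) * w (Suc i) + w i)" for w
    using last XS by auto
  have YXX: "\<phi> (Suc i) * X (X w) (Suc i) = \<phi> (Suc i) * (\<theta> (Suc i) * (\<theta> (Suc i) * w (Suc i) + w i) + X w i)" for w
    using last XS by auto
  have \<kappa>: "\<kappa> = 2 * a * b - c * (2 * of_nat e + 1)" and \<mu>: "\<mu> = 2 * a * c - b * (2 * of_nat e + 1)"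
    by (simp_all add: \<kappa>_def \<mu>_def e)
  note par = Otheta_parity[of e, folded e] Ophi_parity[of e, folded e]
  show ?thesis
  proof (cases i)
    case 0
    have \<theta>: "\<theta> 0 = a - of_nat e" "\<theta> (Suc 0) = - (a - of_nat e + 1)"
       "\<theta>' 0 = b - of_nat e" "\<phi> (Suc 0) = - of_nat e * (2 * of_nat e - 1 - 2 * a - 2 * b + 2 * c)"
      using par(1)[of a 0] par(2)[of a 0] par(1)[of b 0] par(4)[of a b c 0]
      by (simp_all add: \<theta>_def \<theta>'_def \<phi>_def)
    show ?thesis
      using Y[OF le, of "X (X v)"] YXX[of v] YX[of v] Y[OF le, of v] Y[OF le, of "X v"]
      unfolding 0 X0 \<theta> \<kappa> \<mu> by algebra
  next
    \<comment> \<open>Row \<open>i = Suc m\<close> reaches down to coordinate \<open>m - 1\<close>,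
      absent for \<open>m = 0\<close>. The default 0 in \<open>p\<close>, and a closed form
      \<open>T\<close> of \<open>\<theta>' (m - 1)\<close> that has a value at \<open>m = 0\<close>
      too, let one computation cover both cases.\<close>
    case (Suc m)
    define p where "p w = (if m = 0 then 0 else w (m - 1))" for w :: "nat \<Rightarrow> complex"
    define T where "T = (if even m then - (b - of_nat e + of_nat m - 1) else b - of_nat e + of_nat m - 1)"
    have m: "m \<le> d" "Suc m \<le> d" using le Suc by auto
    have Xm: "X w m = \<theta> m * w m + p w" for w
      using m by (cases m) (auto simp: p_def X0 XS)
    have T: "T = \<theta>' (m - 1)" if "m \<noteq> 0"
    proof (cases "even m")
      case True
      then obtain l where "m = 2 * l" by (elim evenE)
      moreover from this that obtain j where "l = Suc j" by (cases l) auto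
      ultimately have "m = Suc (Suc (2 * j))" by simp
      then show ?thesis using par(2)[of b j] by (simp add: T_def \<theta>'_def)
    next
      case False
      then obtain j where "m = Suc (2 * j)" by (elim oddE) simp
      then show ?thesis using par(1)[of b j] by (simp add: T_def \<theta>'_def)
    qed
    have pY: "p (Y w) = T * p w + \<phi> m * w m" for w
    proof (cases "m = 0")
      case True
      then show ?thesis by (simp add: p_def \<phi>_def Ophi_def)
    next
      case False
      then show ?thesis using m Y[of "m - 1" w] T by (simp add: p_def)
    qed
    note eqs = XS[OF m(2)] Xm pY Y[OF m(1)] Y[OF m(2), of v]
    have YXX': "Y (X (X v)) (Suc m) = \<theta>' (Suc m) * (\<theta> (Suc m) * (\<theta> (Suc m) * v (Suc m) + v m) + \<theta> m * v m + p v)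
        + \<phi> (Suc (Suc m)) * (\<theta> (Suc (Suc m)) * (\<theta> (Suc (Suc m)) * v (Suc (Suc m)) + v (Suc m)) +
           \<theta> (Suc m) * v (Suc m) + v m)"
      using YXX[of v] by (auto simp: eqs Suc Y[OF m(2)] add.assoc)
    have YX': "Y (X v) (Suc m) = \<theta>' (Suc m) * (\<theta> (Suc m) * v (Suc m) + v m)
        + \<phi> (Suc (Suc m)) * (\<theta> (Suc (Suc m)) * v (Suc (Suc m)) + v (Suc m))"
      using YX[of v] by (auto simp: eqs Suc Y[OF m(2)] add.assoc)
    show ?thesis
    proof (cases "even m")
      case True
      then obtain j where j: "m = 2 * j" by (elim evenE)
      have \<theta>: "\<theta> m = a - of_nat e + 2 * of_nat j" "\<theta> (Suc m) = - (a - of_nat e + 2 * of_nat j + 1)"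
          "\<theta> (Suc (Suc m)) = a - of_nat e + 2 * of_nat j + 2"
          "\<theta>' m = b - of_nat e + 2 * of_nat j" "\<theta>' (Suc m) = - (b - of_nat e + 2 * of_nat j + 1)"
          "T = - (b - of_nat e + 2 * of_nat j - 1)"
          "\<phi> m = of_nat j * (2 * of_nat e + 1 - 4 * of_nat j - 2 * a - 2 * b - 2 * c)"
          "\<phi> (Suc m) = (of_nat j - of_nat e) * (2 * of_nat e - 1 - 4 * of_nat j - 2 * a - 2 * b + 2 * c)"
          "\<phi> (Suc (Suc m)) = (of_nat j + 1) * (2 * of_nat e - 3 - 4 * of_nat j - 2 * a - 2 * b - 2 * c)"
        using par(1)[of a j] par(1)[of b j] par(2)[of a j] par(2)[of b j] par(1)[of a "Suc j"]
          par(3)[of a b c j] par(4)[of a b c j] par(3)[of a b c "Suc j"]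
        by (simp_all add: \<theta>_def \<theta>'_def \<phi>_def T_def j algebra_simps)
      show ?thesis unfolding Suc YXX' by (simp only: eqs YX' \<theta> \<kappa> \<mu>) algebra
    next
      case False
      then obtain j where j: "m = Suc (2 * j)" by (elim oddE) simp
      have \<theta>: "\<theta> m = - (a - of_nat e + 2 * of_nat j + 1)" "\<theta> (Suc m) = a - of_nat e + 2 * of_nat j + 2"
          "\<theta> (Suc (Suc m)) = - (a - of_nat e + 2 * of_nat j + 3)"
          "\<theta>' m = - (b - of_nat e + 2 * of_nat j + 1)" "\<theta>' (Suc m) = b - of_nat e + 2 * of_nat j + 2"
          "T = b - of_nat e + 2 * of_nat j"
          "\<phi> m = (of_nat j - of_nat e) * (2 * of_nat e - 1 - 4 * of_nat j - 2 * a - 2 * b + 2 * c)"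
          "\<phi> (Suc m) = (of_nat j + 1) * (2 * of_nat e - 3 - 4 * of_nat j - 2 * a - 2 * b - 2 * c)"
          "\<phi> (Suc (Suc m)) = (of_nat j + 1 - of_nat e) * (2 * of_nat e - 5 - 4 * of_nat j - 2 * a - 2 * b + 2 * c)"
        using par(2)[of a j] par(2)[of b j] par(1)[of a "Suc j"] par(1)[of b "Suc j"] par(2)[of a "Suc j"]
          par(4)[of a b c j] par(3)[of a b c "Suc j"] par(4)[of a b c "Suc j"]
        by (simp_all add: \<theta>_def \<theta>'_def \<phi>_def T_def j algebra_simps)
      show ?thesis unfolding Suc YXX' by (simp only: eqs YX' \<theta> \<kappa> \<mu>) algebra
    qed
  qed
qed

section \<open>Reversing the eigenvalues of X\<close>

text \<open>
  Only \<open>X\<close> and \<open>Y\<close> are tracked: on all modules considered, \<open>Z\<close> is \<open>{X,Y}\<close> minus a scalar. A scalar shared by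
  both sides is compared once, at the end.
\<close>
definition pair_quot ::
    "('i \<Rightarrow> complex) set \<Rightarrow> ('i \<Rightarrow> complex) set \<Rightarrow> (('i \<Rightarrow> complex) \<Rightarrow> ('i \<Rightarrow> complex)) \<Rightarrow> (('i \<Rightarrow> complex) \<Rightarrow> ('i \<Rightarrow> complex)) \<Rightarrow>
     ('j \<Rightarrow> complex) set \<Rightarrow> (('j \<Rightarrow> complex) \<Rightarrow> ('j \<Rightarrow> complex)) \<Rightarrow> (('j \<Rightarrow> complex) \<Rightarrow> ('j \<Rightarrow> complex)) \<Rightarrow> bool" where
  "pair_quot A B X Y S X' Y' \<longleftrightarrow> (\<exists>\<phi>. linear_on A \<phi> \<and> \<phi> ` A = S \<and> (\<forall>v\<in>A. \<phi> v = vzero \<longleftrightarrow> v \<in> B) \<and>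
      (\<forall>v\<in>A. \<phi> (X v) = X' (\<phi> v) \<and> \<phi> (Y v) = Y' (\<phi> v)))"

lemma pair_quot_trans:
  assumes "pair_quot A B X Y S X' Y'" "pair_quot S {vzero} X' Y' T X'' Y''"
  shows "pair_quot A B X Y T X'' Y''"
proof -
  from assms obtain \<phi> \<psi> where
    \<phi>: "linear_on A \<phi>" "\<phi> ` A = S" "\<forall>v\<in>A. \<phi> v = vzero \<longleftrightarrow> v \<in> B"
       "\<forall>v\<in>A. \<phi> (X v) = X' (\<phi> v) \<and> \<phi> (Y v) = Y' (\<phi> v)" and
    \<psi>: "linear_on S \<psi>" "\<psi> ` S = T" "\<forall>v\<in>S. \<psi> v = vzero \<longleftrightarrow> v \<in> {vzero}"
       "\<forall>v\<in>S. \<psi> (X' v) = X'' (\<psi> v) \<and> \<psi> (Y' v) = Y'' (\<psi> v)"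
    unfolding pair_quot_def by blast
  have S: "\<phi> v \<in> S" if "v \<in> A" for v using that \<phi>(2) by blast
  have "linear_on A (\<psi> \<circ> \<phi>)" using \<phi>(1) \<psi>(1) S by (simp add: linear_on_def)
  moreover have "(\<psi> \<circ> \<phi>) ` A = T" using \<phi>(2) \<psi>(2) by (metis image_comp)
  moreover have "\<forall>v\<in>A. (\<psi> \<circ> \<phi>) v = vzero \<longleftrightarrow> v \<in> B" using \<phi>(3) \<psi>(3) S by simp
  moreover have "\<forall>v\<in>A. (\<psi> \<circ> \<phi>) (X v) = X'' ((\<psi> \<circ> \<phi>) v) \<and> (\<psi> \<circ> \<phi>) (Y v) = Y'' ((\<psi> \<circ> \<phi>) v)"
    using \<phi>(4) \<psi>(4) S by simp
  ultimately show ?thesis unfolding pair_quot_def by blast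
qed

lemma pair_quot_swap: "pair_quot A B X Y S X' Y' \<Longrightarrow> pair_quot A B Y X S Y' X'"
  unfolding pair_quot_def by blast

lemma pair_quot_scale:
  assumes "pair_quot A B X Y S X' Y'"
    and "\<And>v. v \<in> A \<Longrightarrow> X v \<in> A" "\<And>v. v \<in> A \<Longrightarrow> Y v \<in> A"
  shows "pair_quot A B (\<lambda>v. smul r (X v)) (\<lambda>v. smul s (Y v)) S (\<lambda>v. smul r (X' v)) (\<lambda>v. smul s (Y' v))"
proof -
  from assms obtain \<phi> where
    \<phi>: "linear_on A \<phi>" "\<phi> ` A = S" "\<forall>v\<in>A. \<phi> v = vzero \<longleftrightarrow> v \<in> B"
       "\<forall>v\<in>A. \<phi> (X v) = X' (\<phi> v) \<and> \<phi> (Y v) = Y' (\<phi> v)"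
    unfolding pair_quot_def by blast
  then show ?thesis using assms(2,3) unfolding pair_quot_def linear_on_def by (intro exI[of _ \<phi>]) simp
qed

section \<open>Basis vectors and products of shifted copies of X\<close>

definition unit_seq :: "nat \<Rightarrow> nat \<Rightarrow> complex" where
  "unit_seq i = (\<lambda>j. if j = i then 1 else 0)"

lemma unit_seq_seqs [simp]: "i \<le> d \<Longrightarrow> unit_seq i \<in> seqs d"
  by (auto simp: unit_seq_def seqs_def)

lemma unit_seq_apply: "unit_seq i j = (if j = i then 1 else 0)"
  by (simp add: unit_seq_def)

lemma seqs_closed:
  "v \<in> seqs d \<Longrightarrow> w \<in> seqs d \<Longrightarrow> vadd v w \<in> seqs d" "v \<in> seqs d \<Longrightarrow> smul r v \<in> seqs d" "vzero \<in> seqs d"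
  using subspace_seqs[of d] unfolding subspace_c_def by blast+

text \<open>To prove a linear identity, \<open>S\<close> is taken as the subspace where it holds,
  which leaves only basis vectors to check. The induction runs over truncations of
  \<open>v\<close>.\<close>

lemma seqs_subspace_eq:
  assumes S: "subspace_c S" and E: "\<And>i. i \<le> d \<Longrightarrow> unit_seq i \<in> S" and v: "v \<in> seqs d"
  shows "v \<in> S"
proof -
  have "(\<lambda>j. if j < m then v j else 0) \<in> S" if "m \<le> Suc d" for m
    using that
  proof (induction m)
    case 0
    then show ?case using S by (simp add: subspace_c_def vzero_def)
  next
    case (Suc m)
    have "(\<lambda>j. if j < Suc m then v j else 0) = vadd (\<lambda>j. if j < m then v j else 0) (smul (v m) (unit_seq m))"
      by (auto simp: unit_seq_def fun_eq_iff vec_apply less_Suc_eq)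
    then show ?case using S Suc E[of m] by (simp add: subspace_c_def)
  qed
  moreover have "(\<lambda>j. if j < Suc d then v j else 0) = v"
    using seqs_outside[OF v] by (auto simp: fun_eq_iff)
  ultimately show ?thesis by (metis order_refl)
qed

text \<open>The product of the operators \<open>X - c\<close> over the list \<open>cs\<close>, its
  head applied first.\<close>

definition shifts :: "(('i \<Rightarrow> complex) \<Rightarrow> ('i \<Rightarrow> complex)) \<Rightarrow> complex list \<Rightarrow> ('i \<Rightarrow> complex) \<Rightarrow> ('i \<Rightarrow> complex)" where
  "shifts X cs = fold (\<lambda>c v. vadd (X v) (smul (- c) v)) cs"

text \<open>The factors are polynomials in one linear operator, hence commute.\<close>

lemma shifts_OX_rev: "shifts (OX d a) (rev cs) v = shifts (OX d a) cs v"
proof -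
  have "foldr (\<lambda>c v. vadd (OX d a v) (smul (- c) v)) cs = fold (\<lambda>c v. vadd (OX d a v) (smul (- c) v)) cs"
    by (rule foldr_fold) (auto simp: fun_eq_iff vec_apply OX_vadd OX_smul algebra_simps)
  then show ?thesis by (simp add: shifts_def flip: foldr_conv_fold)
qed

text \<open>On vectors supported from coordinate \<open>j\<close> on,
  \<open>X - Otheta d a j\<close> kills coordinate \<open>j\<close> and so pushes the support up by
  one; after the last factor nothing is left.\<close>

lemma shifts_OX_vanish:
  assumes "v \<in> seqs d" "\<And>i. i < j \<Longrightarrow> v i = 0" "j \<le> Suc d"
  shows "shifts (OX d a) (map (Otheta d a) [j..<Suc d]) v = vzero"
  using assms
proof (induction "Suc d - j" arbitrary: j v)
  case 0
  then have "v i = 0" for i using seqs_outside[of v d i] by (cases "i \<le> d") auto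
  with 0 show ?case by (simp add: shifts_def fun_eq_iff vec_apply)
next
  case (Suc m)
  then have j: "j \<le> d" by simp
  define w where "w = vadd (OX d a v) (smul (- Otheta d a j) v)"
  have w: "w \<in> seqs d" unfolding w_def using Suc.prems by (intro seqs_closed) auto
  have "w i = 0" if "i < Suc j" for i
    using that j Suc.prems(2) by (cases i) (auto simp: w_def vec_apply OX_0 OX_Suc less_Suc_eq)
  then have "shifts (OX d a) (map (Otheta d a) [Suc j..<Suc d]) w = vzero"
    using Suc w j by (intro Suc.hyps(1)) auto
  then show ?case using j by (simp add: shifts_def w_def upt_conv_Cons del: upt_Suc)
qed

lemma shifts_OX_vadd: "shifts (OX d a) cs (vadd v w) = vadd (shifts (OX d a) cs v) (shifts (OX d a) cs w)"
proof (induction cs arbitrary: v w)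
  case (Cons c cs)
  have "vadd (OX d a (vadd v w)) (smul (- c) (vadd v w)) =
        vadd (vadd (OX d a v) (smul (- c) v)) (vadd (OX d a w) (smul (- c) w))"
    by (simp add: fun_eq_iff vec_apply OX_vadd algebra_simps)
  with Cons show ?case by (simp add: shifts_def)
qed (simp add: shifts_def)

lemma shifts_OX_smul: "shifts (OX d a) cs (smul r v) = smul r (shifts (OX d a) cs v)"
proof (induction cs arbitrary: v)
  case (Cons c cs)
  have "vadd (OX d a (smul r v)) (smul (- c) (smul r v)) = smul r (vadd (OX d a v) (smul (- c) v))"
    by (simp add: fun_eq_iff vec_apply OX_smul algebra_simps)
  with Cons show ?case by (simp add: shifts_def)
qed (simp add: shifts_def)

lemma shifts_in_subspace:
  assumes "subspace_c S" "\<And>v. v \<in> S \<Longrightarrow> X v \<in> S" "v \<in> S"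
  shows "shifts X cs v \<in> S"
  using assms(3)
proof (induction cs arbitrary: v)
  case (Cons c cs)
  then have "vadd (X v) (smul (- c) v) \<in> S" using assms(1,2) by (simp add: subspace_c_def)
  from Cons.IH[OF this] show ?case by (simp add: shifts_def)
qed (simp add: shifts_def)

section \<open>The flipped basis and its change-of-basis map\<close>

lemma OX_vzero [simp]: "OX d a vzero = vzero"
  by (auto simp: OX_def fun_eq_iff vec_apply)
lemma OY_vzero [simp]: "OY d a b c vzero = vzero"
  by (auto simp: OY_def fun_eq_iff vec_apply)

text \<open>Chosen so that \<open>- X\<close> is lower bidiagonal along these vectors, with diagonal
  \<open>Otheta d (- a)\<close> and ones below it. For even \<open>d\<close> one has
  \<open>- Otheta d (- a) i = Otheta d a (d - i)\<close>, so up to signs this is the chain using the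
  eigenvalues of \<open>X\<close> in reverse order.\<close>

primrec flip_vec :: "nat \<Rightarrow> complex \<Rightarrow> nat \<Rightarrow> nat \<Rightarrow> complex" where
  "flip_vec d a 0 = unit_seq 0"
| "flip_vec d a (Suc i) =
     vadd (smul (- Otheta d (- a) i) (flip_vec d a i)) (smul (- 1) (OX d a (flip_vec d a i)))"

definition flip_map :: "nat \<Rightarrow> complex \<Rightarrow> (nat \<Rightarrow> complex) \<Rightarrow> nat \<Rightarrow> complex" where
  "flip_map d a v = (\<lambda>x. \<Sum>i\<le>d. v i * flip_vec d a i x)"

lemma Otheta_reverse: "even d \<Longrightarrow> i \<le> d \<Longrightarrow> Otheta d a (d - i) = - Otheta d (- a) i"
  by (auto simp: Otheta_def minus_one_power_iff of_nat_diff field_simps)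

lemma flip_vec_seqs [simp]: "flip_vec d a i \<in> seqs d"
  by (induction i) (auto intro!: seqs_closed)

lemma flip_vec_shifts:
  "flip_vec d a i = smul ((- 1) ^ i) (shifts (OX d a) (map (\<lambda>i. - Otheta d (- a) i) [0..<i]) (unit_seq 0))"
proof (induction i)
  case 0
  then show ?case by (simp add: shifts_def fun_eq_iff vec_apply)
next
  case (Suc i)
  let ?F = "shifts (OX d a) (map (\<lambda>i. - Otheta d (- a) i) [0..<i]) (unit_seq 0)"
  have "shifts (OX d a) (map (\<lambda>i. - Otheta d (- a) i) [0..<Suc i]) (unit_seq 0) =
        vadd (OX d a ?F) (smul (Otheta d (- a) i) ?F)"
    by (simp add: shifts_def)
  then show ?case
    by (simp only: flip_vec.simps Suc OX_smul) (simp add: fun_eq_iff vec_apply algebra_simps)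
qed

lemma rev_map_Otheta:
  assumes "even d"
  shows "map (\<lambda>i. - Otheta d (- a) i) [0..<d] = rev (map (Otheta d a) [1..<Suc d])" (is ?A)
    and "map (\<lambda>i. - Otheta d (- a) i) [0..<Suc d] = rev (map (Otheta d a) [0..<Suc d])" (is ?B)
proof -
  show ?A by (rule nth_equalityI) (use assms in \<open>auto simp: rev_nth Otheta_reverse[symmetric] Suc_diff_Suc simp del: upt_Suc\<close>)
  show ?B by (rule nth_equalityI) (use assms in \<open>auto simp: rev_nth Otheta_reverse[symmetric] simp del: upt_Suc\<close>)
qed

text \<open>Up to sign this is the product of all \<open>X - Otheta d a i\<close> applied to the
  first basis vector, and by triangularity that product annihilates \<open>seqs d\<close>.\<close>

lemma flip_vec_last:
  assumes "even d"
  shows "flip_vec d a (Suc d) = vzero"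
proof -
  have "shifts (OX d a) (map (Otheta d a) [0..<Suc d]) (unit_seq 0) = vzero"
    by (rule shifts_OX_vanish) auto
  then show ?thesis
    unfolding flip_vec_shifts rev_map_Otheta(2)[OF assms] shifts_OX_rev by (simp add: fun_eq_iff vec_apply)
qed

lemma flip_map_vadd: "flip_map d a (vadd v w) = vadd (flip_map d a v) (flip_map d a w)"
  by (simp add: flip_map_def fun_eq_iff vec_apply sum.distrib algebra_simps)
lemma flip_map_smul: "flip_map d a (smul r v) = smul r (flip_map d a v)"
  by (simp add: flip_map_def fun_eq_iff vec_apply sum_distrib_left algebra_simps)

lemma flip_map_vzero [simp]: "flip_map d a vzero = vzero"
  by (simp add: flip_map_def fun_eq_iff vec_apply)

lemma flip_map_unit: "i \<le> d \<Longrightarrow> flip_map d a (unit_seq i) = flip_vec d a i"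
  by (simp add: flip_map_def unit_seq_def fun_eq_iff if_distrib[of "\<lambda>x. x * _"] cong: if_cong)

lemma flip_map_seqs [simp]: "flip_map d a v \<in> seqs d"
  using seqs_outside[OF flip_vec_seqs]
  by (auto simp: seqs_def flip_map_def) (metis (no_types, lifting) linorder_not_less mult_zero_right sum.neutral)

lemma OX_unit:
  assumes "i \<le> d"
  shows "OX d a (unit_seq i) = vadd (smul (Otheta d a i) (unit_seq i)) (if i = d then vzero else unit_seq (Suc i))"
  using assms by (auto simp: OX_def unit_seq_def fun_eq_iff vec_apply)

text \<open>On basis vectors this is the recursion of \<open>flip_vec\<close>. At
  \<open>i = d\<close> there is no next basis vector, in agreement with
  \<open>flip_vec d a (Suc d)\<close> being zero.\<close>

lemma flip_map_OX:
  assumes d: "even d" and v: "v \<in> seqs d"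
  shows "flip_map d a (smul (- 1) (OX d (- a) v)) = OX d a (flip_map d a v)"
proof -
  let ?S = "{v. flip_map d a (smul (- 1) (OX d (- a) v)) = OX d a (flip_map d a v)}"
  have "subspace_c ?S"
    by (simp add: subspace_c_def flip_map_smul flip_map_vadd OX_vadd OX_smul)
       (simp add: fun_eq_iff vec_apply algebra_simps)
  moreover have "unit_seq i \<in> ?S" if i: "i \<le> d" for i
  proof (cases "i = d")
    case True
    with flip_vec_last[OF d, of a] show ?thesis
      by (simp add: OX_unit flip_map_unit flip_map_vadd flip_map_smul fun_eq_iff vec_apply)
  next
    case False
    with i show ?thesis
      by (simp add: OX_unit flip_map_unit flip_map_vadd flip_map_smul fun_eq_iff vec_apply)
  qed
  ultimately show ?thesis using seqs_subspace_eq[OF _ _ v, of ?S] by blast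
qed

lemma flip_map_OX':
  assumes "even d" "v \<in> seqs d"
  shows "flip_map d a (OX d (- a) v) = smul (- 1) (OX d a (flip_map d a v))"
  using flip_map_OX[OF assms, of a] by (simp add: flip_map_smul fun_eq_iff vec_apply) (metis minus_minus)

text \<open>The composite fixes the first basis vector and commutes with \<open>OX d (- a)\<close>,
  under which that vector generates \<open>seqs d\<close>.\<close>

lemma flip_map_inverse:
  assumes d: "even d" and v: "v \<in> seqs d"
  shows "flip_map d (- a) (flip_map d a v) = v"
proof -
  let ?h = "\<lambda>v. flip_map d (- a) (flip_map d a v)"
  let ?S = "{v. ?h v = v}"
  have "subspace_c ?S"
    by (simp add: subspace_c_def flip_map_smul flip_map_vadd)
  moreover have "unit_seq i \<in> ?S" if "i \<le> d" for i
    using that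
  proof (induction i)
    case 0
    then show ?case by (simp add: flip_map_unit)
  next
    case (Suc i)
    have hX: "?h (OX d (- a) w) = OX d (- a) (?h w)" if "w \<in> seqs d" for w
      using flip_map_OX[OF d flip_map_seqs, of "- a" a w] by (simp add: flip_map_OX'[OF d that])
    have E: "unit_seq (Suc i) = vadd (OX d (- a) (unit_seq i)) (smul (- Otheta d (- a) i) (unit_seq i))"
      using Suc.prems by (simp add: OX_unit fun_eq_iff vec_apply)
    have "?h (unit_seq i) = unit_seq i" using Suc by simp
    then show ?case using Suc.prems hX[of "unit_seq i"]
      by (simp add: E flip_map_vadd flip_map_smul)
  qed
  ultimately show ?thesis using seqs_subspace_eq[OF _ _ v, of ?S] by blast
qed


lemma O_relation_vec:
  fixes a b c :: complex and d :: nat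
  defines "X \<equiv> OX d a" and "Y \<equiv> OY d a b c"
    and "\<kappa> \<equiv> 2 * a * b - c * (of_nat d + 1)" and "\<mu> \<equiv> 2 * a * c - b * (of_nat d + 1)"
  assumes d: "even d" and v: "v \<in> seqs d"
  shows "Y (X (X v)) = vadd (vadd (Y v) (vadd (smul \<mu> v) (smul (2 * \<kappa>) (X v))))
           (smul (- 1) (vadd (X (X (Y v))) (smul 2 (X (Y (X v))))))"
  using O_relation[OF d v, of a b c]
  by (auto simp: fun_eq_iff vec_apply X_def Y_def \<kappa>_def \<mu>_def algebra_simps)

text \<open>
  The relation expresses \<open>Y X\<^sup>2\<close> through words with fewer \<open>X\<close> to the right of \<open>Y\<close>, so compatibility
  with \<open>Y\<close> propagates along the chain \<open>v\<^sub>0, X v\<^sub>0, X\<^sup>2 v\<^sub>0, \<dots>\<close> from its first two members.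
\<close>
lemma flip_map_OY:
  assumes d: "even d" and v: "v \<in> seqs d"
  shows "flip_map d a (OY d (- a) b (- c) v) = OY d a b c (flip_map d a v)"
proof -
  define h X Y X' Y' where "h = flip_map d a" and "X = OX d a" and "Y = OY d a b c"
    and "X' = OX d (- a)" and "Y' = OY d (- a) b (- c)"
  note lin = flip_map_smul[of d a, folded h_def] flip_map_vadd[of d a, folded h_def]
    OX_vadd[of d a, folded X_def] OX_smul[of d a, folded X_def]
    OY_vadd[of d a b c, folded Y_def] OY_smul[of d a b c, folded Y_def]
    OX_vadd[of d "- a", folded X'_def] OX_smul[of d "- a", folded X'_def]
    OY_vadd[of d "- a" b "- c", folded Y'_def] OY_smul[of d "- a" b "- c", folded Y'_def]
  have hX: "h (X' w) = smul (- 1) (X (h w))" if "w \<in> seqs d" for w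
    using flip_map_OX'[OF d that, of a] by (simp add: h_def X'_def X_def)
  have seqs: "X' w \<in> seqs d" "Y' w \<in> seqs d" "h w \<in> seqs d" for w
    by (simp_all add: X'_def Y'_def h_def)
  define S where "S = {v. h (Y' v) = Y (h v)}"
  have seqs_in: "subspace_c S"
    by (simp add: subspace_c_def S_def lin) (simp add: Y_def Y'_def h_def)
  \<comment> \<open>Passing to \<open>- a\<close> and \<open>- c\<close> negates
    \<open>\<kappa>\<close> and keeps \<open>\<mu>\<close>, which matches the sign that
    \<open>h\<close> puts on \<open>X\<close>.\<close>
  have step: "X' (X' u) \<in> S" if "u \<in> S" "X' u \<in> S" "u \<in> seqs d" for u
  proof -
    have "h (Y' (X' (X' u))) = Y (h (X' (X' u)))"
      using that O_relation_vec[OF d, of u "- a" b "- c", folded X'_def Y'_def]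
        O_relation_vec[OF d, of "h u" a b c, folded X_def Y_def] seqs
      by (simp add: lin hX S_def) (simp add: fun_eq_iff vec_apply algebra_simps)
    then show ?thesis by (simp add: S_def)
  qed
  have mem: "smul r w \<in> S" "vadd w w' \<in> S" if "w \<in> S" "w' \<in> S" for r w w'
    using seqs_in that by (auto simp: subspace_c_def)
  have E: "unit_seq (Suc i) = vadd (X' (unit_seq i)) (smul (- Otheta d (- a) i) (unit_seq i))"
    if "Suc i \<le> d" for i
    using that by (simp add: X'_def OX_unit fun_eq_iff vec_apply)
  have E0: "unit_seq 0 \<in> S"
  proof -
    have "OY d a b c (unit_seq 0) = smul (Otheta d b 0) (unit_seq 0)" for a c
      by (auto simp: OY_def unit_seq_def fun_eq_iff vec_apply)
    then show ?thesis
      by (simp add: S_def Y_def Y'_def lin h_def flip_map_unit flip_map_smul)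
  qed
  have E1: "X' (unit_seq 0) \<in> S"
  proof (cases "d = 0")
    case True
    then have "X' (unit_seq 0) = smul (Otheta d (- a) 0) (unit_seq 0)"
      by (auto simp: X'_def OX_def unit_seq_def fun_eq_iff vec_apply)
    then show ?thesis using mem E0 by simp
  next
    case False
    then have d1: "Suc 0 \<le> d" by simp
    have Y0: "OY d a b c (unit_seq 0) = smul (Otheta d b 0) (unit_seq 0)" for a c
      by (auto simp: OY_def unit_seq_def fun_eq_iff vec_apply)
    have Y1: "OY d a b c (unit_seq (Suc 0)) =
        vadd (smul (Otheta d b (Suc 0)) (unit_seq (Suc 0))) (smul (Ophi d a b c (Suc 0)) (unit_seq 0))" for a c
      using d1 by (auto simp: OY_def unit_seq_def fun_eq_iff vec_apply)
    \<comment> \<open>Comparing coefficients of the first basis vector, this amounts to \<open>Ophi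
      d a b c 1 + Ophi d (- a) b (- c) 1 = d * (Otheta d b 0 - Otheta d b 1)\<close>.\<close>
    have "unit_seq (Suc 0) \<in> S"
      using d1 by (simp add: S_def Y_def Y'_def lin h_def flip_map_unit flip_map_smul flip_map_vadd Y1
         OY_vadd OY_smul Y0 OX_unit)
       (simp add: fun_eq_iff vec_apply Otheta_def Ophi_def field_simps)
    then have "vadd (unit_seq (Suc 0)) (smul (Otheta d (- a) 0) (unit_seq 0)) \<in> S"
      using mem E0 by blast
    moreover have "vadd (unit_seq (Suc 0)) (smul (Otheta d (- a) 0) (unit_seq 0)) = X' (unit_seq 0)"
      using E[OF d1] by (simp add: fun_eq_iff vec_apply)
    ultimately show ?thesis by simp
  qed
  have "unit_seq i \<in> S \<and> X' (unit_seq i) \<in> S" if "i \<le> d" for i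
    using that
  proof (induction i)
    case 0
    then show ?case using E0 E1 by simp
  next
    case (Suc i)
    then have i: "unit_seq i \<in> S" "X' (unit_seq i) \<in> S" by auto
    have "X' (unit_seq (Suc i)) = vadd (X' (X' (unit_seq i))) (smul (- Otheta d (- a) i) (X' (unit_seq i)))"
      using E[OF Suc.prems] by (simp add: lin)
    then show ?case using E[OF Suc.prems] i step[OF i] Suc.prems mem by simp
  qed
  then have "v \<in> S" using seqs_subspace_eq[OF seqs_in _ v] by blast
  then show ?thesis by (simp add: S_def h_def Y_def Y'_def)
qed

text \<open>The map is \<open>flip_map d (- a)\<close>, which leads out of the module with parameter
  \<open>a\<close>; its inverse is \<open>flip_map d a\<close>.\<close>

lemma O_flip_a:
  assumes d: "even d"
  shows "pair_quot (seqs d) {vzero} (OX d a) (OY d a b c)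
     (seqs d) (\<lambda>v. smul (- 1) (OX d (- a) v)) (OY d (- a) b (- c))"
proof -
  let ?h = "flip_map d (- a)"
  have "linear_on (seqs d) ?h" by (simp add: linear_on_def flip_map_vadd flip_map_smul)
  moreover have "?h ` seqs d = seqs d"
    using flip_map_inverse[OF d, of _ a] by (auto simp: image_iff) (metis flip_map_seqs)
  moreover have "?h v = vzero \<longleftrightarrow> v \<in> {vzero}" if "v \<in> seqs d" for v
    using flip_map_inverse[OF d that, of "- a"]
    by (metis flip_map_vzero minus_minus singleton_iff)
  moreover have "?h (OX d a v) = smul (- 1) (OX d (- a) (?h v))" if "v \<in> seqs d" for v
    using flip_map_OX'[OF d that, of "- a"] by simp
  moreover have "?h (OY d a b c v) = OY d (- a) b (- c) (?h v)" if "v \<in> seqs d" for v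
    using flip_map_OY[OF d that, of "- a" b "- c"] by simp
  ultimately show ?thesis unfolding pair_quot_def by blast
qed

section \<open>Rescaled windows and irreducibility\<close>

text \<open>\<open>e\<close> lists the coordinates of a window on which \<open>U\<close> and
  \<open>L\<close> are upper and lower bidiagonal. A diagonal rescaling preserves the products
  \<open>p i * q (Suc i)\<close>; the one with \<open>r i * q i = r (i - 1)\<close> turns the lower
  entries into ones and the upper ones into these products.\<close>

lemma pair_quot_rescale:
  fixes A :: "(nat \<Rightarrow> complex) set"
  assumes onto: "\<And>w. w \<in> seqs d \<Longrightarrow> \<exists>u\<in>A. \<forall>i\<le>d. u (e i) = w i"
    and B: "\<And>u. u \<in> A \<Longrightarrow> u \<in> B \<longleftrightarrow> (\<forall>i\<le>d. u (e i) = 0)"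
    and U: "\<And>u i. u \<in> A \<Longrightarrow> i \<le> d \<Longrightarrow>
          U u (e i) = Otheta d b i * u (e i) + (if i < d then p i * u (e (Suc i)) else 0)"
    and L: "\<And>u i. u \<in> A \<Longrightarrow> i \<le> d \<Longrightarrow>
          L u (e i) = Otheta d a i * u (e i) + (if i = 0 then 0 else q i * u (e (i - 1)))"
    and q: "\<And>i. 1 \<le> i \<Longrightarrow> i \<le> d \<Longrightarrow> q i \<noteq> 0"
    and pq: "\<And>i. i < d \<Longrightarrow> p i * q (Suc i) = Ophi d a b c (Suc i)"
  shows "pair_quot A B U L (seqs d) (OY d a b c) (OX d a)"
proof -
  define r where "r i = (\<Prod>j=1..i. 1 / q j)" for i
  define P where "P u = (\<lambda>i. if i \<le> d then r i * u (e i) else 0)" for u :: "nat \<Rightarrow> complex"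
  have r_Suc: "r (Suc i) = r i / q (Suc i)" for i by (simp add: r_def)
  have r: "r i \<noteq> 0" if "i \<le> d" for i
    using that q by (auto simp: r_def prod_zero_iff)
  have "linear_on A P" by (simp add: linear_on_def P_def fun_eq_iff vec_apply algebra_simps)
  moreover have "P ` A = seqs d"
  proof
    show "P ` A \<subseteq> seqs d" by (auto simp: P_def seqs_def split: if_splits)
    show "seqs d \<subseteq> P ` A"
    proof
      fix w assume w: "w \<in> seqs d"
      then have "(\<lambda>i. w i / r i) \<in> seqs d" by (auto simp: seqs_def)
      from onto[OF this] obtain u where u: "u \<in> A" "\<forall>i\<le>d. u (e i) = w i / r i" by blast
      have "P u = w" using u r seqs_outside[OF w] by (auto simp: P_def fun_eq_iff)
      with u(1) show "w \<in> P ` A" by blast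
    qed
  qed
  moreover have "P u = vzero \<longleftrightarrow> u \<in> B" if "u \<in> A" for u
    using B[OF that] r by (auto simp: P_def fun_eq_iff vec_apply)
  moreover have "P (U u) = OY d a b c (P u)" if u: "u \<in> A" for u
  proof
    fix i
    show "P (U u) i = OY d a b c (P u) i"
    proof (cases "i < d")
      case True
      have "r i * p i = Ophi d a b c (Suc i) * r (Suc i)"
        using pq[OF True] q[of "Suc i"] True by (simp add: r_Suc field_simps)
      then have "r i * (p i * u (e (Suc i))) = Ophi d a b c (Suc i) * (r (Suc i) * u (e (Suc i)))"
        by (metis mult.assoc)
      with True U[OF u, of i] show ?thesis by (simp add: P_def OY_def algebra_simps)
    qed (use U[OF u, of i] in \<open>auto simp: P_def OY_def\<close>)
  qed
  moreover have "P (L u) = OX d a (P u)" if u: "u \<in> A" for u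
  proof
    fix i
    show "P (L u) i = OX d a (P u) i"
    proof (cases i)
      case 0
      then show ?thesis using L[OF u, of i] by (simp add: P_def OX_def)
    next
      case (Suc j)
      show ?thesis
      proof (cases "i \<le> d")
        case True
        then have "r (Suc j) * q (Suc j) = r j" using q[of "Suc j"] Suc by (simp add: r_Suc)
        then have "r (Suc j) * (q (Suc j) * u (e j)) = r j * u (e j)" by (metis mult.assoc)
        with L[OF u True] Suc True show ?thesis by (simp add: P_def OX_def algebra_simps)
      qed (simp add: P_def OX_def)
    qed
  qed
  ultimately show ?thesis unfolding pair_quot_def by blast
qed

text \<open>The indices \<open>d - i\<close> and \<open>Suc i\<close> have opposite parity, so the
  two branches of \<open>Ophi\<close> are exchanged.\<close>

lemma Ophi_reverse:
  assumes "even d" "i \<le> d"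
  shows "Ophi d a b c (d - i) = Ophi d (- b) (- a) c (Suc i)"
  using assms by (auto simp: Ophi_def of_nat_diff field_simps)

text \<open>Listed backwards, the basis makes \<open>Y\<close> lower and \<open>X\<close> upper
  bidiagonal, with eigenvalues those for \<open>- b\<close> and \<open>- a\<close> up to sign. The
  \<open>Ophi\<close> become subdiagonal entries to be rescaled to ones, so they must not
  vanish.\<close>

lemma O_reverse:
  assumes d: "even d" and \<phi>: "\<And>i. 1 \<le> i \<Longrightarrow> i \<le> d \<Longrightarrow> Ophi d a b c i \<noteq> 0"
  shows "pair_quot (seqs d) {vzero} (OX d a) (OY d a b c)
     (seqs d) (\<lambda>v. smul (- 1) (OY d (- b) (- a) c v)) (\<lambda>v. smul (- 1) (OX d (- b) v))"
proof -
  have "pair_quot (seqs d) {vzero} (\<lambda>v. smul (- 1) (OX d a v)) (\<lambda>v. smul (- 1) (OY d a b c v))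
     (seqs d) (OY d (- b) (- a) c) (OX d (- b))"
  proof (rule pair_quot_rescale[where e = "\<lambda>i. d - i" and p = "\<lambda>i. - 1" and q = "\<lambda>i. - Ophi d a b c (Suc (d - i))"])
    fix w assume w: "w \<in> seqs d"
    show "\<exists>u\<in>seqs d. \<forall>i\<le>d. u (d - i) = w i"
      by (rule bexI[of _ "\<lambda>i. if i \<le> d then w (d - i) else 0"]) (auto simp: seqs_def)
  next
    fix u assume u: "u \<in> seqs d"
    show "u \<in> {vzero} \<longleftrightarrow> (\<forall>i\<le>d. u (d - i) = 0)"
    proof
      assume *: "\<forall>i\<le>d. u (d - i) = 0"
      have "u i = 0" for i
        using *[rule_format, of "d - i"] seqs_outside[OF u, of i] by (cases "i \<le> d") auto
      then show "u \<in> {vzero}" by (simp add: fun_eq_iff vec_apply)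
    qed (simp add: vec_apply)
    fix i assume i: "i \<le> d"
    have t: "Otheta d a (d - i) = - Otheta d (- a) i" "Otheta d b (d - i) = - Otheta d (- b) i"
      using d i by (simp_all add: Otheta_reverse)
    show "smul (- 1) (OX d a u) (d - i) = Otheta d (- a) i * u (d - i) + (if i < d then - 1 * u (d - Suc i) else 0)"
      using i t by (auto simp: vec_apply OX_def)
    show "smul (- 1) (OY d a b c u) (d - i) = Otheta d (- b) i * u (d - i)
        + (if i = 0 then 0 else - Ophi d a b c (Suc (d - i)) * u (d - (i - 1)))"
    proof (cases i)
      case 0
      then show ?thesis using t by (simp add: vec_apply OY_def)
    next
      case (Suc j)
      then have "Suc (d - i) = d - j" using i by simp
      then show ?thesis using i t Suc by (simp add: vec_apply OY_def)
    qed
  next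
    fix i assume "1 \<le> i" "i \<le> d"
    then show "- Ophi d a b c (Suc (d - i)) \<noteq> 0" using \<phi>[of "Suc (d - i)"] by simp
  next
    fix i assume i: "i < d"
    then have "Suc (d - Suc i) = d - i" by simp
    then show "- 1 * - Ophi d a b c (Suc (d - Suc i)) = Ophi d (- b) (- a) c (Suc i)"
      using Ophi_reverse[OF d, of i] i by simp
  qed
  from pair_quot_scale[OF this, of "- 1" "- 1"] show ?thesis
    by (simp add: seqs_closed) (simp add: smul_def)
qed

text \<open>
  As \<open>\<phi>\<^sub>i \<noteq> 0\<close>, a non-zero submodule contains some \<open>s\<close> with \<open>s\<^sub>0 \<noteq> 0\<close>. The product of the \<open>X - \<theta>\<^sub>i\<close> with
  \<open>i \<ge> 1\<close> maps \<open>s\<close> to a multiple of the last vector of the flipped basis, from which \<open>Y\<close> leads back to \<open>v\<^sub>0\<close>.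
\<close>
lemma O_submodule_trivial:
  assumes d: "even d"
    and \<phi>: "\<And>i. 1 \<le> i \<Longrightarrow> i \<le> d \<Longrightarrow> Ophi d a b c i \<noteq> 0"
    and \<phi>': "\<And>i. 1 \<le> i \<Longrightarrow> i \<le> d \<Longrightarrow> Ophi d (- a) b (- c) i \<noteq> 0"
    and S: "S \<subseteq> seqs d" "subspace_c S"
    and X: "\<And>v. v \<in> S \<Longrightarrow> OX d a v \<in> S" and Y: "\<And>v. v \<in> S \<Longrightarrow> OY d a b c v \<in> S"
  shows "S = {vzero} \<or> S = seqs d"
proof (cases "\<forall>s\<in>S. s 0 = 0")
  case True
  have "i \<le> d \<Longrightarrow> \<forall>s\<in>S. s i = 0" for i
  proof (induction i)
    case (Suc i)
    show ?case
    proof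
      fix s assume s: "s \<in> S"
      have "OY d a b c s i = 0" "s i = 0" using Suc s Y by auto
      with Suc.prems have "Ophi d a b c (Suc i) * s (Suc i) = 0" by (simp add: OY_le[OF d])
      with \<phi>[of "Suc i"] Suc.prems show "s (Suc i) = 0" by simp
    qed
  qed (use True in simp)
  then have "s = vzero" if "s \<in> S" for s
    using that S(1) seqs_outside[of s d] by (auto simp: fun_eq_iff vec_apply not_le[symmetric])
  then show ?thesis using S(2) by (auto simp: subspace_c_def)
next
  case False
  then obtain s where s: "s \<in> S" "s 0 \<noteq> 0" by blast
  have mem: "smul r w \<in> S" "vadd w w' \<in> S" if "w \<in> S" "w' \<in> S" for r w w'
    using S(2) that by (auto simp: subspace_c_def)
  let ?p = "shifts (OX d a) (map (Otheta d a) [1..<Suc d])"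
  \<comment> \<open>Without its component along the first basis vector, \<open>s\<close> is
    supported from coordinate 1 on and is killed by \<open>?p\<close>; so only that component
    contributes to \<open>?p s\<close>.\<close>
  have "?p (vadd s (smul (- s 0) (unit_seq 0))) = vzero"
    using s S(1) by (intro shifts_OX_vanish seqs_closed) (auto simp: vec_apply unit_seq_apply)
  then have "?p s = smul (s 0) (?p (unit_seq 0))"
    by (simp add: shifts_OX_vadd shifts_OX_smul fun_eq_iff vec_apply del: upt_Suc)
  moreover have "flip_vec d a d = smul ((- 1) ^ d) (?p (unit_seq 0))"
    unfolding flip_vec_shifts rev_map_Otheta(1)[OF d] shifts_OX_rev ..
  ultimately have "flip_vec d a d = smul (1 / s 0) (?p s)"
    using s(2) d by (simp add: fun_eq_iff vec_apply del: upt_Suc)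
  moreover have "?p s \<in> S" by (rule shifts_in_subspace[OF S(2) X s(1)])
  ultimately have top: "flip_vec d a d \<in> S" using mem by simp
  have "flip_vec d a (d - j) \<in> S" if "j \<le> d" for j
    using that
  proof (induction j)
    case (Suc j)
    define i where "i = d - Suc j"
    have i: "Suc i \<le> d" "d - j = Suc i" using Suc.prems by (auto simp: i_def)
    have E: "OY d (- a) b (- c) (unit_seq (Suc i)) =
        vadd (smul (Otheta d b (Suc i)) (unit_seq (Suc i))) (smul (Ophi d (- a) b (- c) (Suc i)) (unit_seq i))"
      using i by (auto simp: OY_def unit_seq_def fun_eq_iff vec_apply)
    \<comment> \<open>Along the flipped basis \<open>Y\<close> is upper bidiagonal with entries
      \<open>Ophi d (- a) b (- c)\<close>. By \<open>\<phi>'\<close> these are nonzero, so the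
      previous vector can be solved for.\<close>
    have "OY d a b c (flip_vec d a (Suc i)) = flip_map d a (OY d (- a) b (- c) (unit_seq (Suc i)))"
      using i flip_map_OY[OF d, of "unit_seq (Suc i)" a b c] by (simp add: flip_map_unit)
    also have "\<dots> = vadd (smul (Otheta d b (Suc i)) (flip_vec d a (Suc i)))
        (smul (Ophi d (- a) b (- c) (Suc i)) (flip_vec d a i))"
      unfolding E using i by (simp only: flip_map_vadd flip_map_smul flip_map_unit)
    finally have "flip_vec d a i = smul (1 / Ophi d (- a) b (- c) (Suc i))
        (vadd (OY d a b c (flip_vec d a (Suc i))) (smul (- Otheta d b (Suc i)) (flip_vec d a (Suc i))))"
      using \<phi>'[of "Suc i"] i by (simp add: fun_eq_iff vec_apply)
    moreover have g: "flip_vec d a (Suc i) \<in> S" using Suc i by (metis Suc_leD)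
    ultimately have "flip_vec d a i \<in> S" using mem Y[OF g] by metis
    then show ?case by (simp add: i_def)
  qed (use top in simp)
  from this[of d] have E0: "unit_seq 0 \<in> S" by simp
  have "unit_seq i \<in> S" if "i \<le> d" for i
    using that
  proof (induction i)
    case (Suc i)
    have "unit_seq (Suc i) = vadd (OX d a (unit_seq i)) (smul (- Otheta d a i) (unit_seq i))"
      using Suc.prems by (simp add: OX_unit fun_eq_iff vec_apply)
    with Suc mem X show ?case by simp
  qed (rule E0)
  then show ?thesis using S(1) seqs_subspace_eq[OF S(2)] by blast
qed

section \<open>Twists\<close>

definition Z_relation :: "complex \<Rightarrow> ('i \<Rightarrow> complex) set \<Rightarrow> 'i bimod \<Rightarrow> bool" where
  "Z_relation \<kappa> A M \<longleftrightarrow> (\<forall>v\<in>A. opX M v \<in> A \<and> opY M v \<in> A \<and>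
      opZ M v = vadd (vadd (opX M (opY M v)) (opY M (opX M v))) (smul (- \<kappa>) v))"

text \<open>As both sides have \<open>Z = {X,Y} - \<kappa>\<close> with the same
  \<open>\<kappa>\<close>, a map that respects \<open>X\<close> and \<open>Y\<close> also respects
  \<open>Z\<close>.\<close>

lemma bimod_quot_isoI:
  assumes "pair_quot A B (opX M) (opY M) (car W) (opX W) (opY W)"
    and A: "subspace_c A" and "B \<subseteq> A" and M: "Z_relation \<kappa> A M" and W: "Z_relation \<kappa> (car W) W"
  shows "bimod_quot_iso M A B W"
proof -
  from assms(1) obtain \<phi> where
    \<phi>: "linear_on A \<phi>" "\<phi> ` A = car W" "\<forall>v\<in>A. \<phi> v = vzero \<longleftrightarrow> v \<in> B"
       "\<forall>v\<in>A. \<phi> (opX M v) = opX W (\<phi> v) \<and> \<phi> (opY M v) = opY W (\<phi> v)"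
    unfolding pair_quot_def by blast
  have "\<phi> (opZ M v) = opZ W (\<phi> v)" if v: "v \<in> A" for v
  proof -
    have "opX M v \<in> A" "opY M v \<in> A" "opX M (opY M v) \<in> A" "opY M (opX M v) \<in> A"
      using M v by (auto simp: Z_relation_def)
    moreover have "\<phi> v \<in> car W" using v \<phi>(2) by blast
    ultimately show ?thesis
      using v M W \<phi>(1,4) A by (simp add: Z_relation_def linear_on_def subspace_c_def)
  qed
  with \<phi> \<open>B \<subseteq> A\<close> show ?thesis unfolding bimod_quot_iso_def intertwines_def by blast
qed

lemma bimod_quot_iso_imp_iso:
  assumes "bimod_quot_iso M A {vzero} W" "subspace_c A"
  shows "bimod_iso (M\<lparr>car := A\<rparr>) W"
proof -
  from assms(1) obtain \<phi> where
    \<phi>: "linear_on A \<phi>" "\<phi> ` A = car W" "\<forall>v\<in>A. \<phi> v = vzero \<longleftrightarrow> v = vzero" "intertwines M W A \<phi>"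
    unfolding bimod_quot_iso_def by auto
  have "inj_on \<phi> A"
  proof
    fix x y assume xy: "x \<in> A" "y \<in> A" "\<phi> x = \<phi> y"
    let ?z = "vadd x (smul (- 1) y)"
    have "?z \<in> A" using xy assms(2) by (simp add: subspace_c_def)
    moreover have "\<phi> ?z = vadd (\<phi> x) (smul (- 1) (\<phi> y))"
      using xy \<phi>(1) assms(2) by (simp add: linear_on_def subspace_c_def)
    then have "\<phi> ?z = vzero" using xy by (simp add: fun_eq_iff vec_apply)
    ultimately have "?z = vzero" using \<phi>(3) by blast
    then show "x = y" by (simp add: fun_eq_iff vec_apply)
  qed
  with \<phi> show ?thesis
    unfolding bimod_iso_def bij_betw_def by (intro exI[of _ \<phi>]) (simp add: intertwines_def)
qed

lemma bimod_isoI: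
  assumes "pair_quot (car M) {vzero} (opX M) (opY M) (car W) (opX W) (opY W)"
    and "subspace_c (car M)" and "Z_relation \<kappa> (car M) M" and "Z_relation \<kappa> (car W) W"
  shows "bimod_iso M W"
proof -
  have "{vzero} \<subseteq> car M" using assms(2) by (auto simp: subspace_c_def)
  from bimod_quot_iso_imp_iso[OF bimod_quot_isoI[OF assms(1,2) this assms(3,4)] assms(2)]
  show ?thesis by simp
qed

lemma Omod_simps [simp]:
  "car (Omod d a b c) = seqs d" "opX (Omod d a b c) = OX d a" "opY (Omod d a b c) = OY d a b c"
  by (simp_all add: Omod_def seqs_def)

lemma Z_relation_Omod: "Z_relation (2 * a * b - c * (of_nat d + 1)) (seqs d) (Omod d a b c)"
  by (simp add: Z_relation_def Omod_def)

definition twist1 where "twist1 d a b c = twist (sign_aut (-1) 1) swap12 (Omod d a b c)"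
definition twist2 where "twist2 d a b c = twist (sign_aut 1 (-1)) swap12 (Omod d a b c)"
definition twist3 where "twist3 d a b c = twist (sign_aut 1 (-1)) id (Omod d a b c)"

lemma twist_simps [simp]:
  "car (twist1 d a b c) = seqs d" "opX (twist1 d a b c) = (\<lambda>v. smul 1 (OY d a b c v))" "opY (twist1 d a b c) = (\<lambda>v. smul (- 1) (OX d a v))"
  "car (twist2 d a b c) = seqs d" "opX (twist2 d a b c) = (\<lambda>v. smul (- 1) (OY d a b c v))" "opY (twist2 d a b c) = (\<lambda>v. smul 1 (OX d a v))"
  "car (twist3 d a b c) = seqs d" "opX (twist3 d a b c) = (\<lambda>v. smul 1 (OX d a v))" "opY (twist3 d a b c) = (\<lambda>v. smul (- 1) (OY d a b c v))"
  by (simp_all add: twist1_def twist2_def twist3_def twist_def sign_aut_def swap12_def gen_def)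

text \<open>Each twist puts a minus sign on exactly one of the images of \<open>X\<close> and
  \<open>Y\<close>, and on \<open>Z\<close>; so \<open>{X,Y}\<close> and \<open>Z\<close> both
  change sign, and with them the scalar.\<close>

lemma Z_relation_twist:
  "Z_relation (- (2 * a * b - c * (of_nat d + 1))) (seqs d) (twist1 d a b c)"
  "Z_relation (- (2 * a * b - c * (of_nat d + 1))) (seqs d) (twist2 d a b c)"
  "Z_relation (- (2 * a * b - c * (of_nat d + 1))) (seqs d) (twist3 d a b c)"
proof -
  have Z: "opZ (twist1 d a b c) = (\<lambda>v. smul (- 1) (opZ (Omod d a b c) v))"
     "opZ (twist2 d a b c) = (\<lambda>v. smul (- 1) (opZ (Omod d a b c) v))"
     "opZ (twist3 d a b c) = (\<lambda>v. smul (- 1) (opZ (Omod d a b c) v))"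
    by (simp_all add: twist1_def twist2_def twist3_def twist_def sign_aut_def swap12_def gen_def)
  show "Z_relation (- (2 * a * b - c * (of_nat d + 1))) (seqs d) (twist1 d a b c)"
  "Z_relation (- (2 * a * b - c * (of_nat d + 1))) (seqs d) (twist2 d a b c)"
  "Z_relation (- (2 * a * b - c * (of_nat d + 1))) (seqs d) (twist3 d a b c)"
    by (simp_all add: Z_relation_def Z seqs_closed)
       (simp_all add: Omod_def OX_smul OY_smul fun_eq_iff vec_apply algebra_simps)
qed

lemma smul_smul: "smul r (smul s v) = smul (r * s) v" by (simp add: smul_def mult.assoc)
lemma smul_one [simp]: "smul 1 v = v" by (simp add: smul_def)

lemma pair_quot_scale_O:
  assumes "pair_quot (seqs d) {vzero} X Y S X' Y'" "\<And>v. X v \<in> seqs d" "\<And>v. Y v \<in> seqs d"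
  shows "pair_quot (seqs d) {vzero} (\<lambda>v. smul r (X v)) (\<lambda>v. smul s (Y v)) S (\<lambda>v. smul r (X' v)) (\<lambda>v. smul s (Y' v))"
  by (rule pair_quot_scale[OF assms(1)]) (simp_all add: assms)

section \<open>Isomorphisms and irreducibility of the twisted modules\<close>

context
  fixes d :: nat and a b c :: complex
  assumes d: "even d"
    and \<phi>: "\<And>i. 1 \<le> i \<Longrightarrow> i \<le> d \<Longrightarrow> Ophi d a b c i \<noteq> 0"
    and \<phi>': "\<And>i. 1 \<le> i \<Longrightarrow> i \<le> d \<Longrightarrow> Ophi d (- a) b (- c) i \<noteq> 0"
begin

text \<open>Reversal takes the pair (Y, -X) of \<open>Omod d a b c\<close> to (-X, Y) of
  \<open>Omod d (- b) (- a) c\<close>; the flip then restores the sign of X.\<close>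

lemma twist1_iso: "bimod_iso (twist1 d a b c) (Omod d b (- a) (- c))"
proof -
  have "pair_quot (seqs d) {vzero} (\<lambda>v. smul 1 (OY d a b c v)) (\<lambda>v. smul (- 1) (OX d a v))
     (seqs d) (\<lambda>v. smul (- 1) (OX d (- b) v)) (\<lambda>v. smul 1 (OY d (- b) (- a) c v))"
    using pair_quot_scale_O[OF pair_quot_swap[OF O_reverse[OF d \<phi>]], of 1 "- 1"]
    by (simp add: smul_smul)
  moreover have "pair_quot (seqs d) {vzero} (\<lambda>v. smul (- 1) (OX d (- b) v)) (\<lambda>v. smul 1 (OY d (- b) (- a) c v))
     (seqs d) (OX d b) (OY d b (- a) (- c))"
    using pair_quot_scale_O[OF O_flip_a[OF d, of "- b" "- a" c], of "- 1" 1]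
    by (simp add: smul_smul)
  ultimately have "pair_quot (seqs d) {vzero} (\<lambda>v. smul 1 (OY d a b c v)) (\<lambda>v. smul (- 1) (OX d a v))
     (seqs d) (OX d b) (OY d b (- a) (- c))"
    by (rule pair_quot_trans)
  then show ?thesis
    using Z_relation_twist(1)[of a b c d] Z_relation_Omod[of b "- a" "- c" d]
    by (intro bimod_isoI) (auto simp: algebra_simps)
qed

text \<open>Here the flip comes first, and the reversal acts on the flipped parameters; this is why
  it needs \<open>\<phi>'\<close>.\<close>

lemma twist2_iso: "bimod_iso (twist2 d a b c) (Omod d (- b) a (- c))"
proof -
  have "pair_quot (seqs d) {vzero} (\<lambda>v. smul (- 1) (OY d a b c v)) (\<lambda>v. smul 1 (OX d a v))
     (seqs d) (\<lambda>v. smul (- 1) (OY d (- a) b (- c) v)) (\<lambda>v. smul (- 1) (OX d (- a) v))"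
    using pair_quot_scale_O[OF pair_quot_swap[OF O_flip_a[OF d, of a b c]], of "- 1" 1]
    by simp
  moreover have "pair_quot (seqs d) {vzero} (\<lambda>v. smul (- 1) (OY d (- a) b (- c) v)) (\<lambda>v. smul (- 1) (OX d (- a) v))
     (seqs d) (OX d (- b)) (OY d (- b) a (- c))"
    using pair_quot_scale_O[OF pair_quot_swap[OF O_reverse[OF d \<phi>']], of "- 1" "- 1"]
    by (simp add: smul_smul)
  ultimately have "pair_quot (seqs d) {vzero} (\<lambda>v. smul (- 1) (OY d a b c v)) (\<lambda>v. smul 1 (OX d a v))
     (seqs d) (OX d (- b)) (OY d (- b) a (- c))"
    by (rule pair_quot_trans)
  then show ?thesis
    using Z_relation_twist(2)[of a b c d] Z_relation_Omod[of "- b" a "- c" d]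
    by (intro bimod_isoI) (auto simp: algebra_simps)
qed

text \<open>A flip conjugated by reversals changes the sign of the second parameter instead of the
  first. The second reversal starts from \<open>Omod d b (- a) (- c)\<close>, which
  \<open>\<phi>'\<close> covers because \<open>Ophi\<close> is symmetric in its first two
  parameters.\<close>

lemma twist3_iso: "bimod_iso (twist3 d a b c) (Omod d a (- b) (- c))"
proof -
  have "Ophi d b (- a) (- c) i = Ophi d (- a) b (- c) i" for i
    by (simp add: Ophi_def algebra_simps)
  with \<phi>' have \<phi>'': "\<And>i. 1 \<le> i \<Longrightarrow> i \<le> d \<Longrightarrow> Ophi d b (- a) (- c) i \<noteq> 0" by simp
  have "pair_quot (seqs d) {vzero} (\<lambda>v. smul 1 (OX d a v)) (\<lambda>v. smul (- 1) (OY d a b c v))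
     (seqs d) (\<lambda>v. smul (- 1) (OY d (- b) (- a) c v)) (\<lambda>v. smul 1 (OX d (- b) v))"
    using pair_quot_scale_O[OF O_reverse[OF d \<phi>], of 1 "- 1"] by (simp add: smul_smul)
  moreover have "pair_quot (seqs d) {vzero} (\<lambda>v. smul (- 1) (OY d (- b) (- a) c v)) (\<lambda>v. smul 1 (OX d (- b) v))
     (seqs d) (\<lambda>v. smul (- 1) (OY d b (- a) (- c) v)) (\<lambda>v. smul (- 1) (OX d b v))"
    using pair_quot_scale_O[OF pair_quot_swap[OF O_flip_a[OF d, of "- b" "- a" c]], of "- 1" 1] by simp
  ultimately have "pair_quot (seqs d) {vzero} (\<lambda>v. smul 1 (OX d a v)) (\<lambda>v. smul (- 1) (OY d a b c v))
     (seqs d) (\<lambda>v. smul (- 1) (OY d b (- a) (- c) v)) (\<lambda>v. smul (- 1) (OX d b v))"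
    by (rule pair_quot_trans)
  moreover have "pair_quot (seqs d) {vzero} (\<lambda>v. smul (- 1) (OY d b (- a) (- c) v)) (\<lambda>v. smul (- 1) (OX d b v))
     (seqs d) (OX d a) (OY d a (- b) (- c))"
    using pair_quot_scale_O[OF pair_quot_swap[OF O_reverse[OF d \<phi>'']], of "- 1" "- 1"]
    by (simp add: smul_smul)
  ultimately have "pair_quot (seqs d) {vzero} (\<lambda>v. smul 1 (OX d a v)) (\<lambda>v. smul (- 1) (OY d a b c v))
     (seqs d) (OX d a) (OY d a (- b) (- c))"
    by (rule pair_quot_trans)
  then show ?thesis
    using Z_relation_twist(3)[of a b c d] Z_relation_Omod[of a "- b" "- c" d]
    by (intro bimod_isoI) (auto simp: algebra_simps)
qed

text \<open>A twist permutes the generators up to sign, so it has the same invariant subspaces;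
  stability under X and Y already decides.\<close>

lemma twist_irred:
  "bimod_irred (twist1 d a b c)" "bimod_irred (twist2 d a b c)" "bimod_irred (twist3 d a b c)"
proof -
  have neg: "w \<in> S" if "subspace_c S" "smul (- 1) w \<in> S" for w :: "nat \<Rightarrow> complex" and S
    using that unfolding subspace_c_def by (metis minus_mult_minus mult_1 smul_one smul_smul)
  have nz: "seqs d \<noteq> {vzero}"
    using unit_seq_seqs[of 0 d] by (auto simp: unit_seq_def vzero_def fun_eq_iff) (metis zero_neq_one)
  have "S = {vzero} \<or> S = seqs d"
    if "S \<subseteq> seqs d" "subspace_c S" "\<forall>v\<in>S. OX d a v \<in> S \<or> smul (- 1) (OX d a v) \<in> S"
      "\<forall>v\<in>S. OY d a b c v \<in> S \<or> smul (- 1) (OY d a b c v) \<in> S" for S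
    using O_submodule_trivial[OF d \<phi> \<phi>' that(1,2)] that neg by blast
  with nz show "bimod_irred (twist1 d a b c)" "bimod_irred (twist2 d a b c)" "bimod_irred (twist3 d a b c)"
    unfolding bimod_irred_def by auto
qed

end

section \<open>The module of initial values\<close>

text \<open>The factor by which T_i takes x_i^m to x_i^(m-1), for \<open>r = k i\<close>. For
  \<open>m > 0\<close> it vanishes exactly when \<open>m\<close> is odd and
  \<open>2 * r = - m\<close>, that is, when \<open>m\<close> is the finite value of
  \<open>tpar r\<close>.\<close>

definition dunkl_coeff :: "real \<Rightarrow> nat \<Rightarrow> complex" where
  "dunkl_coeff r m = of_nat m + of_real r * (1 - (- 1) ^ m)"

text \<open>
  The argument \<open>a\<close> stands for the monomial \<open>x\<^sub>1\<^sup>a x\<^sub>2\<^bsup>n-a\<^esup>\<close>; the sign is \<open>(-1)\<^bsup>n-a\<^esup> = (-1)\<^sup>a\<close> because \<open>n\<close> is even.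
\<close>
definition VX :: "(nat \<Rightarrow> real) \<Rightarrow> nat \<Rightarrow> (nat \<Rightarrow> complex) \<Rightarrow> nat \<Rightarrow> complex" where
  "VX k n u = (\<lambda>a. if a \<le> n then (- 1) ^ a *
     ((of_nat n - of_nat a + of_real (k 2) + of_real (k 3) + 1 / 2) * u a + dunkl_coeff (k 1) (Suc a) * u (Suc a)) else 0)"

definition VY :: "(nat \<Rightarrow> real) \<Rightarrow> nat \<Rightarrow> (nat \<Rightarrow> complex) \<Rightarrow> nat \<Rightarrow> complex" where
  "VY k n u = (\<lambda>a. if a \<le> n then (- 1) ^ a *
     ((of_nat a + of_real (k 1) + of_real (k 3) + 1 / 2) * u a +
      (if a = 0 then 0 else dunkl_coeff (k 2) (Suc n - a) * u (a - 1))) else 0)"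

definition VZ :: "(nat \<Rightarrow> real) \<Rightarrow> nat \<Rightarrow> (nat \<Rightarrow> complex) \<Rightarrow> nat \<Rightarrow> complex" where
  "VZ k n u = (\<lambda>a. if a \<le> n then (1 / 2 + (- 1) ^ a * (of_real (k 1) + of_real (k 2))) * u a
     - dunkl_coeff (k 1) (Suc a) * u (Suc a)
     - (if a = 0 then 0 else dunkl_coeff (k 2) (Suc n - a) * u (a - 1)) else 0)"

definition V :: "(nat \<Rightarrow> real) \<Rightarrow> nat \<Rightarrow> nat bimod" where
  "V k n = \<lparr>car = seqs n, opX = VX k n, opY = VY k n, opZ = VZ k n\<rparr>"

lemma V_simps [simp]: "opX (V k n) = VX k n" "opY (V k n) = VY k n" "opZ (V k n) = VZ k n"
  by (simp_all add: V_def)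

lemma VX_seqs [simp]: "VX k n u \<in> seqs n" and VY_seqs [simp]: "VY k n u \<in> seqs n"
  by (auto simp: VX_def VY_def seqs_def split: if_splits)

lemma VZ_eq:
  fixes k :: "nat \<Rightarrow> real" and n :: nat
  defines "\<kappa> \<equiv> of_real (2 * k 1 * k 2 + 2 * k 3 * (k 1 + k 2 + k 3 + real n + 1))"
  assumes n: "even n" and u: "u \<in> seqs n"
  shows "VZ k n u = vadd (vadd (VX k n (VY k n u)) (VY k n (VX k n u))) (smul (- \<kappa>) u)"
proof
  fix a
  show "VZ k n u a = vadd (vadd (VX k n (VY k n u)) (VY k n (VX k n u))) (smul (- \<kappa>) u) a"
  proof (cases "a \<le> n")
    case False
    then show ?thesis using seqs_outside[OF u, of a] by (simp add: VX_def VY_def VZ_def vec_apply)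
  next
    case a: True
    define g1 g2 where "g1 = dunkl_coeff (k 1)" and "g2 = dunkl_coeff (k 2)"
    define k1 k2 k3 :: complex where "k1 = of_real (k 1)" and "k2 = of_real (k 2)" and "k3 = of_real (k 3)"
    define s :: complex where "s = (- 1) ^ a"
    define l where "l = (if a = 0 then 0 else u (a - 1))"
    have s: "s * s = 1" by (simp add: s_def flip: power_mult_distrib)
    have X: "VX k n w a = s * ((of_nat n - of_nat a + k2 + k3 + 1 / 2) * w a + g1 (Suc a) * w (Suc a))" for w
      using a by (simp add: VX_def s_def k2_def k3_def g1_def)
    have Y: "VY k n w a = s * ((of_nat a + k1 + k3 + 1 / 2) * w a + g2 (Suc n - a) * (if a = 0 then 0 else w (a - 1)))" for w
      using a by (simp add: VY_def s_def k1_def k3_def g2_def)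
    have X1: "(if a = 0 then 0 else VX k n u (a - 1)) = (if a = 0 then 0 else - s * ((of_nat n - of_nat a + 1 + k2 + k3 + 1 / 2) * l + g1 a * u a))"
      using a by (cases a) (auto simp: VX_def s_def k2_def k3_def g1_def l_def)
    have Y1: "VY k n u (Suc a) = (if Suc a \<le> n then - s * ((of_nat a + 1 + k1 + k3 + 1 / 2) * u (Suc a) + g2 (n - a) * u a) else 0)"
      using a by (auto simp: VY_def s_def k1_def k3_def g2_def)
    \<comment> \<open>At either end of the range the missing neighbour comes with the coefficient
      \<open>dunkl_coeff _ 0\<close>, which is zero.\<close>
    have g20: "g2 (n - a) = 0" "u (Suc a) = 0" if "\<not> Suc a \<le> n"
      using that a seqs_outside[OF u, of "Suc a"] by (auto simp: g2_def dunkl_coeff_def)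
    have g10: "g1 a = 0" "l = 0" if "a = 0"
      using that by (auto simp: g1_def l_def dunkl_coeff_def)
    have XY: "VX k n (VY k n u) a = s * ((of_nat n - of_nat a + k2 + k3 + 1 / 2) * (s * ((of_nat a + k1 + k3 + 1 / 2) * u a + g2 (Suc n - a) * l))
        - g1 (Suc a) * (s * ((of_nat a + 1 + k1 + k3 + 1 / 2) * u (Suc a) + g2 (n - a) * u a)))"
      unfolding X Y Y1 using g20 by (auto simp: l_def)
    have YX: "VY k n (VX k n u) a = s * ((of_nat a + k1 + k3 + 1 / 2) * (s * ((of_nat n - of_nat a + k2 + k3 + 1 / 2) * u a + g1 (Suc a) * u (Suc a)))
        - g2 (Suc n - a) * (s * ((of_nat n - of_nat a + 1 + k2 + k3 + 1 / 2) * l + g1 a * u a)))"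
      unfolding X Y X1 using g10 by auto
    have Z: "VZ k n u a = (1 / 2 + s * (k1 + k2)) * u a - g1 (Suc a) * u (Suc a) - g2 (Suc n - a) * l"
      using a by (simp add: VZ_def s_def k1_def k2_def g1_def g2_def l_def)
    have \<kappa>: "\<kappa> = 2 * k1 * k2 + 2 * k3 * (k1 + k2 + k3 + of_nat n + 1)"
      by (simp add: \<kappa>_def k1_def k2_def k3_def)
    have na: "of_nat (Suc n - a) = (of_nat n - of_nat a + 1 :: complex)" "of_nat (n - a) = (of_nat n - of_nat a :: complex)"
      using a by (simp_all add: of_nat_diff)
    \<comment> \<open>The off-diagonal parts agree because the linear factors on the diagonals of X
      and Y change by 1 from row to row. What remains is this diagonal identity, checked for each
      parity.\<close>
    have diag: "g1 (Suc a) * g2 (n - a) + g2 (Suc n - a) * g1 a =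
      (of_nat n - of_nat a + k2 + k3 + 1 / 2) * (of_nat a + k1 + k3 + 1 / 2) * 2 - \<kappa> - (1 / 2 + s * (k1 + k2))"
    proof (cases "even a")
      case True
      then have eqs: "g1 (Suc a) = of_nat a + 1 + 2 * k1" "g1 a = of_nat a" "s = 1"
         "g2 (n - a) = of_nat n - of_nat a" "g2 (Suc n - a) = of_nat n - of_nat a + 1 + 2 * k2"
        using n a by (simp_all add: g1_def g2_def dunkl_coeff_def s_def k1_def k2_def na)
      show ?thesis unfolding eqs \<kappa> by (simp add: field_simps)
    next
      case False
      then have eqs: "g1 a = of_nat a + 2 * k1" "g1 (Suc a) = of_nat a + 1" "s = -1"
         "g2 (Suc n - a) = of_nat n - of_nat a + 1" "g2 (n - a) = of_nat n - of_nat a + 2 * k2"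
        using n a by (simp_all add: g1_def g2_def dunkl_coeff_def s_def k1_def k2_def na)
      show ?thesis unfolding eqs \<kappa> by (simp add: field_simps)
    qed
    show ?thesis unfolding vec_apply XY YX Z using s diag by algebra
  qed
qed

section \<open>Submodules cut out by bounds on the exponent\<close>

definition seqs_in :: "nat \<Rightarrow> (nat \<Rightarrow> bool) \<Rightarrow> (nat \<Rightarrow> complex) set" where
  "seqs_in n P = {u \<in> seqs n. \<forall>a. u a \<noteq> 0 \<longrightarrow> P a}"

lemma subspace_seqs_in: "subspace_c (seqs_in n P)"
  using subspace_seqs[of n] unfolding subspace_c_def seqs_in_def
  by (auto simp: vec_apply) (metis add_0)

lemma seqs_inI: "v \<in> seqs n \<Longrightarrow> (\<And>a. \<not> P a \<Longrightarrow> v a = 0) \<Longrightarrow> v \<in> seqs_in n P"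
  by (auto simp: seqs_in_def)

lemma seqs_inD: "v \<in> seqs_in n P \<Longrightarrow> \<not> P a \<Longrightarrow> v a = 0"
  by (auto simp: seqs_in_def)

text \<open>\<open>VX\<close> moves the support down by at most one and \<open>VY\<close> never
  moves it down. The only way out leads from \<open>t1\<close> to \<open>t1 - 1\<close>, with
  coefficient \<open>dunkl_coeff (k 1) t1\<close>.\<close>

lemma V_invariant_lower:
  assumes "dunkl_coeff (k 1) t1 = 0" "u \<in> seqs_in n (\<lambda>a. t1 \<le> a)"
  shows "VX k n u \<in> seqs_in n (\<lambda>a. t1 \<le> a)" "VY k n u \<in> seqs_in n (\<lambda>a. t1 \<le> a)"
proof -
  have u: "u a = 0" if "a < t1" for a using that seqs_inD[OF assms(2)] by simp
  have "VX k n u a = 0" if "a < t1" for a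
    using that u[of a] u[of "Suc a"] assms(1) by (cases "Suc a = t1") (auto simp: VX_def)
  then show "VX k n u \<in> seqs_in n (\<lambda>a. t1 \<le> a)" by (intro seqs_inI) auto
  have "VY k n u a = 0" if "a < t1" for a
    using that u[of a] u[of "a - 1"] by (auto simp: VY_def)
  then show "VY k n u \<in> seqs_in n (\<lambda>a. t1 \<le> a)" by (intro seqs_inI) auto
qed

text \<open>Here only \<open>VY\<close> could leave the range, going from \<open>n - t2\<close> to
  \<open>n - t2 + 1\<close>; the coefficient of that step is
  \<open>dunkl_coeff (k 2) t2\<close>.\<close>

lemma V_invariant_upper:
  assumes "dunkl_coeff (k 2) t2 = 0" "u \<in> seqs_in n (\<lambda>a. a + t2 \<le> n)"
  shows "VX k n u \<in> seqs_in n (\<lambda>a. a + t2 \<le> n)" "VY k n u \<in> seqs_in n (\<lambda>a. a + t2 \<le> n)"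
proof -
  have u: "u a = 0" if "n < a + t2" for a using that seqs_inD[OF assms(2)] by simp
  have "VX k n u a = 0" if "n < a + t2" for a
    using that u[of a] u[of "Suc a"] by (auto simp: VX_def)
  then show "VX k n u \<in> seqs_in n (\<lambda>a. a + t2 \<le> n)" by (intro seqs_inI) auto
  have "VY k n u a = 0" if "n < a + t2" for a
  proof (cases "n < (a - 1) + t2")
    case True
    then show ?thesis using that u[of a] u[of "a - 1"] by (auto simp: VY_def)
  next
    case False
    then have "Suc n - a = t2" if "a \<le> n" "a \<noteq> 0" using that \<open>n < a + t2\<close> by auto
    then show ?thesis using that u[of a] assms(1) by (auto simp: VY_def)
  qed
  then show "VY k n u \<in> seqs_in n (\<lambda>a. a + t2 \<le> n)" by (intro seqs_inI) auto
qed


section \<open>The three windows as modules O\<close>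

context
  fixes k :: "nat \<Rightarrow> real" and n t1 t2 :: nat
  assumes n: "even n" and t: "odd t1" "odd t2" "t1 + t2 \<le> n"
    and k1: "2 * k 1 = - real t1" and k2: "2 * k 2 = - real t2"
begin

lemma k_complex: "complex_of_real (k (Suc 0)) = - of_nat t1 / 2" "complex_of_real (k 1) = - of_nat t1 / 2" "complex_of_real (k 2) = - of_nat t2 / 2"
proof -
  have "k 1 = - real t1 / 2" "k 2 = - real t2 / 2" using k1 k2 by auto
  then show "complex_of_real (k (Suc 0)) = - of_nat t1 / 2" "complex_of_real (k 1) = - of_nat t1 / 2" "complex_of_real (k 2) = - of_nat t2 / 2" by simp_all
qed

lemma dunkl_coeff_eqs:
  "dunkl_coeff (k (Suc 0)) m = (if even m then of_nat m else of_nat m - of_nat t1)"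
  "dunkl_coeff (k 1) m = (if even m then of_nat m else of_nat m - of_nat t1)"
  "dunkl_coeff (k 2) m = (if even m then of_nat m else of_nat m - of_nat t2)"
  by (simp_all add: dunkl_coeff_def k_complex)

lemma dunkl_coeff_neq_0:
  "t1 < m \<Longrightarrow> dunkl_coeff (k 1) m \<noteq> 0" "t2 < m \<Longrightarrow> dunkl_coeff (k 2) m \<noteq> 0"
  by (simp_all add: dunkl_coeff_eqs)

lemma window_middle:
  fixes N :: real
  defines "N \<equiv> (real n + 1) / 2"
  shows "pair_quot (seqs_in n (\<lambda>a. t1 \<le> a) \<inter> seqs_in n (\<lambda>a. a + t2 \<le> n)) {vzero} (VX k n) (VY k n)
    (seqs (n - t1 - t2))
    (OY (n - t1 - t2) (of_real (k 2 + k 3 + N)) (of_real (- k 1 - k 3 - N)) (of_real (- N)))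
    (\<lambda>v. smul (- 1) (OX (n - t1 - t2) (of_real (k 2 + k 3 + N)) v))"
proof -
  define d where "d = n - t1 - t2"
  let ?A = "seqs_in n (\<lambda>a. t1 \<le> a) \<inter> seqs_in n (\<lambda>a. a + t2 \<le> n)"
  have d: "n = t1 + t2 + d" using t by (simp add: d_def)
  have "pair_quot ?A {vzero} (VX k n) (\<lambda>v. smul (- 1) (VY k n v)) (seqs d)
    (OY d (of_real (k 2 + k 3 + N)) (of_real (- k 1 - k 3 - N)) (of_real (- N)))
    (OX d (of_real (k 2 + k 3 + N)))"
  \<comment> \<open>The window starts at the odd number \<open>t1\<close>, so the sign at
    \<open>t1 + i\<close> is the opposite of \<open>(- 1) ^ i\<close>; hence the lower bidiagonal
    matrix is that of \<open>- Y\<close>.\<close>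
  proof (rule pair_quot_rescale[where e = "\<lambda>i. t1 + i" and p = "\<lambda>i. - ((- 1) ^ i) * dunkl_coeff (k 1) (Suc (t1 + i))"
        and q = "\<lambda>i. (- 1) ^ i * dunkl_coeff (k 2) (Suc n - (t1 + i))"])
    fix w assume w: "w \<in> seqs d"
    show "\<exists>u\<in>?A. \<forall>i\<le>d. u (t1 + i) = w i"
      by (rule bexI[of _ "\<lambda>a. if t1 \<le> a \<and> a \<le> t1 + d then w (a - t1) else 0"])
         (auto simp: seqs_in_def seqs_def d)
  next
    fix u assume u: "u \<in> ?A"
    have out: "u a = 0" if "a < t1 \<or> t1 + d < a" for a
      using that u seqs_inD[of u n "\<lambda>a. t1 \<le> a" a] seqs_inD[of u n "\<lambda>a. a + t2 \<le> n" a] d by auto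
    show "u \<in> {vzero} \<longleftrightarrow> (\<forall>i\<le>d. u (t1 + i) = 0)"
    proof
      assume *: "\<forall>i\<le>d. u (t1 + i) = 0"
      have "u a = 0" for a
        using *[rule_format, of "a - t1"] out[of a] by (cases "t1 \<le> a \<and> a \<le> t1 + d") auto
      then show "u \<in> {vzero}" by (simp add: fun_eq_iff vec_apply)
    qed (simp add: vec_apply)
    fix i assume i: "i \<le> d"
    show "VX k n u (t1 + i) = Otheta d (of_real (- k 1 - k 3 - N)) i * u (t1 + i) +
        (if i < d then - ((- 1) ^ i) * dunkl_coeff (k 1) (Suc (t1 + i)) * u (t1 + Suc i) else 0)"
      using i t out[of "Suc (t1 + d)"] d
      by (cases "i = d") (auto simp: VX_def Otheta_def N_def k_complex power_add field_simps)
    show "smul (- 1) (VY k n u) (t1 + i) = Otheta d (of_real (k 2 + k 3 + N)) i * u (t1 + i) +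
        (if i = 0 then 0 else (- 1) ^ i * dunkl_coeff (k 2) (Suc n - (t1 + i)) * u (t1 + (i - 1)))"
      using i t out[of "t1 - 1"] d
      by (cases i) (auto simp: VY_def Otheta_def N_def k_complex vec_apply power_add field_simps)
  next
    fix i assume "1 \<le> i" "i \<le> d"
    then show "(- 1) ^ i * dunkl_coeff (k 2) (Suc n - (t1 + i)) \<noteq> 0"
      using dunkl_coeff_neq_0(2)[of "Suc n - (t1 + i)"] d by simp
  next
    fix i assume i: "i < d"
    have "Suc n - (t1 + Suc i) = t2 + d - i" using i d by simp
    moreover have "even d" using n t d by auto
    ultimately show "- ((- 1) ^ i) * dunkl_coeff (k 1) (Suc (t1 + i)) * ((- 1) ^ Suc i * dunkl_coeff (k 2) (Suc n - (t1 + Suc i)))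
       = Ophi d (of_real (k 2 + k 3 + N)) (of_real (- k 1 - k 3 - N)) (of_real (- N)) (Suc i)"
      using i t by (cases "even i") (simp_all add: dunkl_coeff_eqs Ophi_def N_def k_complex d of_nat_diff field_simps)
  qed
  then have "pair_quot ?A {vzero} (\<lambda>v. smul 1 (VX k n v)) (\<lambda>v. smul (- 1) (smul (- 1) (VY k n v))) (seqs d)
    (\<lambda>v. smul 1 (OY d (of_real (k 2 + k 3 + N)) (of_real (- k 1 - k 3 - N)) (of_real (- N)) v))
    (\<lambda>v. smul (- 1) (OX d (of_real (k 2 + k 3 + N)) v))"
  proof (rule pair_quot_scale)
    fix v assume v: "v \<in> ?A"
    have "dunkl_coeff (k 1) t1 = 0" "dunkl_coeff (k 2) t2 = 0" using t by (simp_all add: dunkl_coeff_eqs)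
    then show "VX k n v \<in> ?A" "smul (- 1) (VY k n v) \<in> ?A"
      using v V_invariant_lower[of k t1 v n] V_invariant_upper[of k t2 v n] subspace_seqs_in[of n]
      by (auto simp: subspace_c_def)
  qed
  then show ?thesis by (simp add: smul_smul d_def)
qed


text \<open>Left open is which invariant \<open>A\<close> the quotient is taken of:
  \<open>seqs n\<close> and the range \<open>a + t2 \<le> n\<close> give the two quotients
  isomorphic to \<open>W2 \<oplus> W2\<close> in (ii).\<close>

lemma window_left:
  fixes K :: real
  defines "K \<equiv> k 1 + k 2 + k 3"
  assumes A: "A \<subseteq> seqs n" "seqs_in n (\<lambda>a. a < t1) \<subseteq> A"
    and inv: "\<And>v. v \<in> A \<Longrightarrow> VX k n v \<in> A" "\<And>v. v \<in> A \<Longrightarrow> VY k n v \<in> A" "subspace_c A"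
  shows "pair_quot A (A \<inter> seqs_in n (\<lambda>a. t1 \<le> a)) (VX k n) (VY k n) (seqs (t1 - 1))
    (\<lambda>v. smul (- 1) (OY (t1 - 1) (of_real (k 3)) (of_real (- K - real n - 1)) (of_real (- k 2)) v))
    (OX (t1 - 1) (of_real (k 3)))"
proof -
  define d where "d = t1 - 1"
  have d: "t1 = Suc d" "d \<le> n" using t by (auto simp: d_def elim!: oddE)
  have "pair_quot A (A \<inter> seqs_in n (\<lambda>a. t1 \<le> a)) (\<lambda>v. smul (- 1) (VX k n v)) (VY k n) (seqs d)
    (OY d (of_real (k 3)) (of_real (- K - real n - 1)) (of_real (- k 2)))
    (OX d (of_real (k 3)))"
  proof (rule pair_quot_rescale[where e = "\<lambda>i. i" and p = "\<lambda>i. - ((- 1) ^ i) * dunkl_coeff (k 1) (Suc i)"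
        and q = "\<lambda>i. (- 1) ^ i * dunkl_coeff (k 2) (Suc n - i)"])
    fix w assume w: "w \<in> seqs d"
    have "w \<in> seqs_in n (\<lambda>a. a < t1)"
      using w d(2) unfolding seqs_in_def seqs_def d(1) less_Suc_eq_le by (auto intro: order_trans)
    with A(2) have "w \<in> A" by blast
    then show "\<exists>u\<in>A. \<forall>i\<le>d. u i = w i" by blast
  next
    fix u assume u: "u \<in> A"
    then show "u \<in> A \<inter> seqs_in n (\<lambda>a. t1 \<le> a) \<longleftrightarrow> (\<forall>i\<le>d. u i = 0)"
      using A(1) d by (auto simp: seqs_in_def Suc_le_eq) (meson not_le)
    fix i assume i: "i \<le> d"
    \<comment> \<open>This broken link removes the upper term in row \<open>i = d\<close>, although
      \<open>u (Suc d)\<close> may be nonzero.\<close>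
    have "dunkl_coeff (k 1) (Suc d) = 0" using t d by (simp add: dunkl_coeff_eqs)
    then show "smul (- 1) (VX k n u) i = Otheta d (of_real (- K - real n - 1)) i * u i +
        (if i < d then - ((- 1) ^ i) * dunkl_coeff (k 1) (Suc i) * u (Suc i) else 0)"
      using i d by (cases "i = d") (auto simp: VX_def Otheta_def K_def k_complex vec_apply field_simps)
    show "VY k n u i = Otheta d (of_real (k 3)) i * u i +
        (if i = 0 then 0 else (- 1) ^ i * dunkl_coeff (k 2) (Suc n - i) * u (i - 1))"
      using i d by (cases i) (auto simp: VY_def Otheta_def k_complex field_simps)
  next
    fix i assume "1 \<le> i" "i \<le> d"
    then show "(- 1) ^ i * dunkl_coeff (k 2) (Suc n - i) \<noteq> 0"
      using dunkl_coeff_neq_0(2)[of "Suc n - i"] d t by simp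
  next
    fix i assume i: "i < d"
    then have "i \<le> n" using d by simp
    moreover have "even d" using t d by auto
    ultimately show "- ((- 1) ^ i) * dunkl_coeff (k 1) (Suc i) * ((- 1) ^ Suc i * dunkl_coeff (k 2) (Suc n - Suc i))
       = Ophi d (of_real (k 3)) (of_real (- K - real n - 1)) (of_real (- k 2)) (Suc i)"
      using i n t by (cases "even i") (simp_all add: dunkl_coeff_eqs Ophi_def K_def k_complex d of_nat_diff field_simps)
  qed
  then have "pair_quot A (A \<inter> seqs_in n (\<lambda>a. t1 \<le> a)) (\<lambda>v. smul (- 1) (smul (- 1) (VX k n v))) (\<lambda>v. smul 1 (VY k n v)) (seqs d)
    (\<lambda>v. smul (- 1) (OY d (of_real (k 3)) (of_real (- K - real n - 1)) (of_real (- k 2)) v))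
    (\<lambda>v. smul 1 (OX d (of_real (k 3)) v))"
    by (rule pair_quot_scale) (use inv in \<open>auto simp: subspace_c_def\<close>)
  then show ?thesis by (simp add: smul_smul d_def)
qed

text \<open>Read from the top, through \<open>a = n - i\<close>, this is the situation of
  \<open>window_left\<close> with X and Y, \<open>t1\<close> and \<open>t2\<close>,
  \<open>k 1\<close> and \<open>k 2\<close> exchanged.\<close>

lemma window_right:
  fixes K :: real
  defines "K \<equiv> k 1 + k 2 + k 3"
  assumes A: "A \<subseteq> seqs n" "seqs_in n (\<lambda>a. n < a + t2) \<subseteq> A"
    and inv: "\<And>v. v \<in> A \<Longrightarrow> VX k n v \<in> A" "\<And>v. v \<in> A \<Longrightarrow> VY k n v \<in> A" "subspace_c A"
  shows "pair_quot A (A \<inter> seqs_in n (\<lambda>a. a + t2 \<le> n)) (VX k n) (VY k n) (seqs (t2 - 1))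
    (OX (t2 - 1) (of_real (k 3)))
    (\<lambda>v. smul (- 1) (OY (t2 - 1) (of_real (k 3)) (of_real (- K - real n - 1)) (of_real (- k 1)) v))"
proof -
  define d where "d = t2 - 1"
  have d: "t2 = Suc d" "d \<le> n" using t by (auto simp: d_def elim!: oddE)
  have "pair_quot A (A \<inter> seqs_in n (\<lambda>a. a + t2 \<le> n)) (\<lambda>v. smul (- 1) (VY k n v)) (VX k n) (seqs d)
    (OY d (of_real (k 3)) (of_real (- K - real n - 1)) (of_real (- k 1)))
    (OX d (of_real (k 3)))"
  proof (rule pair_quot_rescale[where e = "\<lambda>i. n - i" and p = "\<lambda>i. - ((- 1) ^ i) * dunkl_coeff (k 2) (Suc i)"
        and q = "\<lambda>i. (- 1) ^ i * dunkl_coeff (k 1) (Suc n - i)"])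
    fix w assume w: "w \<in> seqs d"
    have "(\<lambda>a. if a \<le> n then w (n - a) else 0) \<in> A"
      using A(2) d seqs_outside[OF w] by (intro subsetD[OF A(2)]) (auto simp: seqs_in_def seqs_def not_le[symmetric])
    then show "\<exists>u\<in>A. \<forall>i\<le>d. u (n - i) = w i"
      using d by (intro bexI[of _ "\<lambda>a. if a \<le> n then w (n - a) else 0"]) auto
  next
    fix u assume u: "u \<in> A"
    show "u \<in> A \<inter> seqs_in n (\<lambda>a. a + t2 \<le> n) \<longleftrightarrow> (\<forall>i\<le>d. u (n - i) = 0)"
    proof
      assume "u \<in> A \<inter> seqs_in n (\<lambda>a. a + t2 \<le> n)"
      then show "\<forall>i\<le>d. u (n - i) = 0" using d seqs_inD[of u n "\<lambda>a. a + t2 \<le> n"] by auto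
    next
      assume *: "\<forall>i\<le>d. u (n - i) = 0"
      have "u a = 0" if "\<not> a + t2 \<le> n" for a
        using *[rule_format, of "n - a"] that d u A(1) seqs_outside[of u n a] by (cases "a \<le> n") auto
      then show "u \<in> A \<inter> seqs_in n (\<lambda>a. a + t2 \<le> n)" using u A(1) by (auto intro: seqs_inI)
    qed
    fix i assume i: "i \<le> d"
    then have i': "i \<le> n" "Suc n - i = Suc (n - i)" using d by auto
    have s: "(- 1) ^ (n - i) = (- 1 :: complex) ^ i"
      using n i' by (simp add: minus_one_power_iff)
    have "dunkl_coeff (k 2) (Suc d) = 0" using t d by (simp add: dunkl_coeff_eqs)
    then show "smul (- 1) (VY k n u) (n - i) = Otheta d (of_real (- K - real n - 1)) i * u (n - i) +
        (if i < d then - ((- 1) ^ i) * dunkl_coeff (k 2) (Suc i) * u (n - Suc i) else 0)"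
      using i d i' s t by (cases "i = d") (auto simp: VY_def Otheta_def K_def k_complex vec_apply of_nat_diff field_simps)
    show "VX k n u (n - i) = Otheta d (of_real (k 3)) i * u (n - i) +
        (if i = 0 then 0 else (- 1) ^ i * dunkl_coeff (k 1) (Suc n - i) * u (n - (i - 1)))"
    proof (cases i)
      case 0
      then show ?thesis using n u A(1) seqs_outside[of u n "Suc n"]
        by (auto simp: VX_def Otheta_def k_complex d field_simps)
    next
      case (Suc j)
      then have "Suc (n - Suc j) = n - j" using i' by simp
      then show ?thesis using i d i' s Suc by (auto simp: VX_def Otheta_def k_complex of_nat_diff field_simps)
    qed
  next
    fix i assume "1 \<le> i" "i \<le> d"
    then show "(- 1) ^ i * dunkl_coeff (k 1) (Suc n - i) \<noteq> 0"
      using dunkl_coeff_neq_0(1)[of "Suc n - i"] d t by simp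
  next
    fix i assume i: "i < d"
    then have "i \<le> n" using d by simp
    moreover have "even d" using t d by auto
    ultimately show "- ((- 1) ^ i) * dunkl_coeff (k 2) (Suc i) * ((- 1) ^ Suc i * dunkl_coeff (k 1) (Suc n - Suc i))
       = Ophi d (of_real (k 3)) (of_real (- K - real n - 1)) (of_real (- k 1)) (Suc i)"
      using i n t by (cases "even i") (simp_all add: dunkl_coeff_eqs Ophi_def K_def k_complex d of_nat_diff field_simps)
  qed
  then have "pair_quot A (A \<inter> seqs_in n (\<lambda>a. a + t2 \<le> n)) (\<lambda>v. smul (- 1) (smul (- 1) (VY k n v))) (\<lambda>v. smul 1 (VX k n v)) (seqs d)
    (\<lambda>v. smul (- 1) (OY d (of_real (k 3)) (of_real (- K - real n - 1)) (of_real (- k 1)) v))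
    (\<lambda>v. smul 1 (OX d (of_real (k 3)) v))"
    by (rule pair_quot_scale) (use inv in \<open>auto simp: subspace_c_def\<close>)
  from pair_quot_swap[OF this] show ?thesis by (simp add: smul_smul d_def)
qed

end

section \<open>Restriction to the plane\<close>

lemma pauli_act_simps:
  "pauli_act 1 f (m, 0) = f (m, 1)" "pauli_act 1 f (m, 1) = f (m, 0)"
  "pauli_act 2 f (m, 0) = - \<i> * f (m, 1)" "pauli_act 2 f (m, 1) = \<i> * f (m, 0)"
  "pauli_act 3 f (m, 0) = f (m, 0)" "pauli_act 3 f (m, 1) = - f (m, 1)"
  "s \<noteq> 0 \<Longrightarrow> s \<noteq> 1 \<Longrightarrow> pauli_act i f (m, s) = 0"
  by (auto simp: pauli_act_def pauli_def numeral_2_eq_2 lessThan_Suc)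

lemma dunkl_simps:
  "dunkl k 1 f ((a, b, c), s) = dunkl_coeff (k 1) (Suc a) * f ((Suc a, b, c), s)"
  "dunkl k 2 f ((a, b, c), s) = dunkl_coeff (k 2) (Suc b) * f ((a, Suc b, c), s)"
  "dunkl k 3 f ((a, b, c), s) = dunkl_coeff (k 3) (Suc c) * f ((a, b, Suc c), s)"
  by (simp_all add: dunkl_def dunkl_coeff_def)

lemma mulx_simps:
  "mulx 1 f ((a, b, c), s) = (if a = 0 then 0 else f ((a - 1, b, c), s))"
  "mulx 2 f ((a, b, c), s) = (if b = 0 then 0 else f ((a, b - 1, c), s))"
  "mulx 3 f ((a, b, c), s) = (if c = 0 then 0 else f ((a, b, c - 1), s))"
  by (simp_all add: mulx_def)

lemma refl_op_simps:
  "refl_op 1 f ((a, b, c), s) = (- 1) ^ a * f ((a, b, c), s)"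
  "refl_op 2 f ((a, b, c), s) = (- 1) ^ b * f ((a, b, c), s)"
  "refl_op 3 f ((a, b, c), s) = (- 1) ^ c * f ((a, b, c), s)"
  by (simp_all add: refl_op_def)

lemmas op_simps = pauli_act_simps pauli_act_simps[unfolded One_nat_def] dunkl_simps dunkl_simps[unfolded One_nat_def]
  mulx_simps mulx_simps[unfolded One_nat_def] refl_op_simps refl_op_simps[unfolded One_nat_def] vec_apply

lemma Pn_outside: "f \<in> Pn n \<Longrightarrow> a + b + c \<noteq> n \<or> 2 \<le> s \<Longrightarrow> f ((a, b, c), s) = 0"
  unfolding Pn_def by (metis (mono_tags, lifting) mem_Collect_eq not_le)

lemma dirac_apply:
  "dirac k f ((a, b, c), 0) = dunkl_coeff (k 1) (Suc a) * f ((Suc a, b, c), 1)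
     - \<i> * dunkl_coeff (k 2) (Suc b) * f ((a, Suc b, c), 1) + dunkl_coeff (k 3) (Suc c) * f ((a, b, Suc c), 0)"
  "dirac k f ((a, b, c), 1) = dunkl_coeff (k 1) (Suc a) * f ((Suc a, b, c), 0)
     + \<i> * dunkl_coeff (k 2) (Suc b) * f ((a, Suc b, c), 0) - dunkl_coeff (k 3) (Suc c) * f ((a, b, Suc c), 1)"
  "s \<noteq> 0 \<Longrightarrow> s \<noteq> 1 \<Longrightarrow> dirac k f ((a, b, c), s) = 0"
  by (simp_all add: dirac_def op_simps)

text \<open>The Dirac equation solved for its T_3 term. It determines the coefficients at x_3^(c+1)
  from those at x_3^c in the other coordinate of C^2.\<close>

lemma Mn_recursion:
  assumes "f \<in> Mn k n"
  shows "dunkl_coeff (k 3) (Suc c) * f ((a, b, Suc c), 0) =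
      - dunkl_coeff (k 1) (Suc a) * f ((Suc a, b, c), 1) + \<i> * dunkl_coeff (k 2) (Suc b) * f ((a, Suc b, c), 1)"
    and "dunkl_coeff (k 3) (Suc c) * f ((a, b, Suc c), 1) =
      dunkl_coeff (k 1) (Suc a) * f ((Suc a, b, c), 0) + \<i> * dunkl_coeff (k 2) (Suc b) * f ((a, Suc b, c), 0)"
proof -
  have "dirac k f ((a, b, c), s) = 0" for s using assms by (simp add: Mn_def vec_apply)
  from this[of 0] this[of 1] show "dunkl_coeff (k 3) (Suc c) * f ((a, b, Suc c), 0) =
      - dunkl_coeff (k 1) (Suc a) * f ((Suc a, b, c), 1) + \<i> * dunkl_coeff (k 2) (Suc b) * f ((a, Suc b, c), 1)"
    "dunkl_coeff (k 3) (Suc c) * f ((a, b, Suc c), 1) =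
      dunkl_coeff (k 1) (Suc a) * f ((Suc a, b, c), 0) + \<i> * dunkl_coeff (k 2) (Suc b) * f ((a, Suc b, c), 0)"
    unfolding dirac_apply by algebra+
qed

definition side :: "bool \<Rightarrow> nat" where "side b = (if b then 0 else 1)"

text \<open>The powers of this factor make the two coordinates isomorphic and remove \<open>\<i>\<close> from the matrices.\<close>
definition phase :: "bool \<Rightarrow> complex" where "phase b = (if b then - \<i> else \<i>)"

definition restr :: "nat \<Rightarrow> bool \<Rightarrow> (idx \<Rightarrow> complex) \<Rightarrow> nat \<Rightarrow> complex" where
  "restr n b f = (\<lambda>a. if a \<le> n then phase b ^ a * f ((a, n - a, 0), side b) else 0)"

lemma restr_seqs [simp]: "restr n b f \<in> seqs n"
  by (auto simp: restr_def seqs_def split: if_splits)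

lemma restr_vadd: "restr n b (vadd f g) = vadd (restr n b f) (restr n b g)"
  and restr_smul: "restr n b (smul r f) = smul r (restr n b f)"
  by (auto simp: restr_def fun_eq_iff vec_apply algebra_simps)

text \<open>On the plane x_3 T_2 vanishes, and T_3 is replaced through the Dirac recursion by T_1
  and T_2. Both e_1 and the recursion exchange the coordinates of C^2, so in total each is mapped to
  itself.\<close>

lemma restr_X:
  assumes n: "even n" and f: "f \<in> Mn k n"
  shows "restr n b (Gop k 1 3 2 2 3 f) = VX k n (restr n b f)"
proof
  fix a
  show "restr n b (Gop k 1 3 2 2 3 f) a = VX k n (restr n b f) a"
  proof (cases "a \<le> n")
    case a: True
    have s: "(- 1) ^ (n - a) = (- 1 :: complex) ^ a"
      using n a by (simp add: minus_one_power_iff)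
    show ?thesis
    proof (cases "n - a")
      case 0
      \<comment> \<open>The monomial x_1^n has no factor x_2, so x_2 T_3 contributes nothing to its
        coefficient.\<close>
      then have "a = n" using a by simp
      then show ?thesis using n
        by (cases b) (simp_all add: restr_def VX_def side_def Gop_def Let_def Lop_def op_simps algebra_simps)
    next
      case (Suc m)
      then have m: "n - Suc a = m" "Suc a \<le> n" "of_nat n = (of_nat a + of_nat m + 1 :: complex)"
        using a by (simp_all) (metis Suc add_Suc_right le_add_diff_inverse of_nat_Suc of_nat_add add.commute)
      define e :: complex where "e = (- 1) ^ a"
      have ee: "e * e = 1" by (simp add: e_def flip: power_mult_distrib)
      have c: "dunkl_coeff (k 2) (Suc m) = of_nat m + 1 + of_real (k 2) * (1 - e)"
        using s Suc by (simp add: dunkl_coeff_def e_def)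
      have e: "(- 1) ^ m = - e" "(- 1) ^ a = e"
        using s Suc unfolding e_def by (metis minus_minus mult_minus1 power_Suc) simp
      note r = Mn_recursion[OF f, of 0 a m]
      have X: "Gop k 1 3 2 2 3 f ((a, Suc m, 0), 0) =
          - \<i> * e * (dunkl_coeff (k 3) (Suc 0) * f ((a, m, Suc 0), 1))
          + (e * (1 / 2 + of_real (k 3)) + of_real (k 2)) * f ((a, Suc m, 0), 0)"
        "Gop k 1 3 2 2 3 f ((a, Suc m, 0), 1) =
          - \<i> * e * (dunkl_coeff (k 3) (Suc 0) * f ((a, m, Suc 0), 0))
          + (e * (1 / 2 + of_real (k 3)) + of_real (k 2)) * f ((a, Suc m, 0), 1)"
        by (simp_all add: Gop_def Let_def Lop_def op_simps e algebra_simps)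
      have "Gop k 1 3 2 2 3 f ((a, Suc m, 0), 0) =
          e * ((of_nat n - of_nat a + of_real (k 2) + of_real (k 3) + 1 / 2) * f ((a, Suc m, 0), 0)
          + dunkl_coeff (k 1) (Suc a) * (- \<i> * f ((Suc a, m, 0), 0)))"
        unfolding X(1) r(2) c m(3) using ee i_squared by algebra
      moreover have "Gop k 1 3 2 2 3 f ((a, Suc m, 0), 1) =
          e * ((of_nat n - of_nat a + of_real (k 2) + of_real (k 3) + 1 / 2) * f ((a, Suc m, 0), 1)
          + dunkl_coeff (k 1) (Suc a) * (\<i> * f ((Suc a, m, 0), 1)))"
        unfolding X(2) r(1) c m(3) using ee i_squared by algebra
      ultimately have G: "Gop k 1 3 2 2 3 f ((a, Suc m, 0), side b) =
          e * ((of_nat n - of_nat a + of_real (k 2) + of_real (k 3) + 1 / 2) * f ((a, Suc m, 0), side b)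
          + dunkl_coeff (k 1) (Suc a) * (phase b * f ((Suc a, m, 0), side b)))"
        by (simp add: side_def phase_def)
      have "phase b ^ a * Gop k 1 3 2 2 3 f ((a, Suc m, 0), side b) =
          e * ((of_nat n - of_nat a + of_real (k 2) + of_real (k 3) + 1 / 2) * (phase b ^ a * f ((a, Suc m, 0), side b))
          + dunkl_coeff (k 1) (Suc a) * (phase b ^ Suc a * f ((Suc a, m, 0), side b)))"
        unfolding G by (simp add: algebra_simps)
      with a m(1,2) show ?thesis
        by (simp add: restr_def VX_def Suc e del: One_nat_def power_Suc)
    qed
  qed (simp add: restr_def VX_def)
qed

lemma restr_Y:
  assumes n: "even n" and f: "f \<in> Mn k n"
  shows "restr n b (Gop k 2 1 3 1 3 f) = VY k n (restr n b f)"
proof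
  fix a
  show "restr n b (Gop k 2 1 3 1 3 f) a = VY k n (restr n b f) a"
  proof (cases "a \<le> n")
    case a: True
    show ?thesis
    proof (cases a)
      case 0
      then show ?thesis
        by (cases b) (simp_all add: restr_def VY_def side_def Gop_def Let_def Lop_def op_simps algebra_simps)
    next
      case (Suc m)
      define l where "l = n - a"
      have l: "n - m = Suc l" "n - a = l" "Suc n - a = Suc l" "m \<le> n"
        using a Suc by (auto simp: l_def)
      define e :: complex where "e = (- 1) ^ a"
      have ee: "e * e = 1" by (simp add: e_def flip: power_mult_distrib)
      have c: "dunkl_coeff (k 1) a = of_nat a + of_real (k 1) * (1 - e)"
        by (simp add: dunkl_coeff_def e_def)
      have e: "(- 1) ^ a = e" "(- 1) ^ m = - e" by (simp_all add: e_def Suc)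
      note r = Mn_recursion[OF f, of 0 m l, folded Suc]
      have Y: "Gop k 2 1 3 1 3 f ((a, l, 0), 0) = e * (dunkl_coeff (k 3) (Suc 0) * f ((m, l, Suc 0), 1))
          + (e * (1 / 2 + of_real (k 3)) + of_real (k 1)) * f ((a, l, 0), 0)"
        "Gop k 2 1 3 1 3 f ((a, l, 0), 1) = - e * (dunkl_coeff (k 3) (Suc 0) * f ((m, l, Suc 0), 0))
          + (e * (1 / 2 + of_real (k 3)) + of_real (k 1)) * f ((a, l, 0), 1)"
        using Suc by (simp_all add: Gop_def Let_def Lop_def op_simps e algebra_simps)
      have "Gop k 2 1 3 1 3 f ((a, l, 0), 0) =
          e * ((of_nat a + of_real (k 1) + of_real (k 3) + 1 / 2) * f ((a, l, 0), 0)
          + dunkl_coeff (k 2) (Suc l) * (\<i> * f ((m, Suc l, 0), 0)))"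
        unfolding Y(1) r(2) c using ee by algebra
      moreover have "Gop k 2 1 3 1 3 f ((a, l, 0), 1) =
          e * ((of_nat a + of_real (k 1) + of_real (k 3) + 1 / 2) * f ((a, l, 0), 1)
          + dunkl_coeff (k 2) (Suc l) * (- \<i> * f ((m, Suc l, 0), 1)))"
        unfolding Y(2) r(1) c using ee by algebra
      ultimately have G: "Gop k 2 1 3 1 3 f ((a, l, 0), side b) =
          e * ((of_nat a + of_real (k 1) + of_real (k 3) + 1 / 2) * f ((a, l, 0), side b)
          + dunkl_coeff (k 2) (Suc l) * (- phase b * f ((m, Suc l, 0), side b)))"
        by (simp add: side_def phase_def)
      have "phase b ^ a * Gop k 2 1 3 1 3 f ((a, l, 0), side b) =
          e * ((of_nat a + of_real (k 1) + of_real (k 3) + 1 / 2) * (phase b ^ a * f ((a, l, 0), side b))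
          + dunkl_coeff (k 2) (Suc l) * (- (phase b * phase b) * phase b ^ m * f ((m, Suc l, 0), side b)))"
        unfolding G by (simp add: Suc algebra_simps)
      \<comment> \<open>One factor comes from the coefficient of \<open>Y\<close>, the other from
        the weights of the exponents \<open>a\<close> and \<open>m = a - 1\<close>; this is how the
        imaginary unit disappears.\<close>
      moreover have "- (phase b * phase b) = 1" by (simp add: phase_def)
      ultimately show ?thesis
        using a l Suc by (simp add: restr_def VY_def e_def del: One_nat_def power_Suc)
    qed
  qed (simp add: restr_def VY_def)
qed

lemma restr_Z:
  assumes n: "even n" and f: "f \<in> Mn k n"
  shows "restr n b (Gop k 3 2 1 1 2 f) = VZ k n (restr n b f)"
proof
  fix a
  show "restr n b (Gop k 3 2 1 1 2 f) a = VZ k n (restr n b f) a"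
  proof (cases "a \<le> n")
    case a: True
    define l where "l = n - a"
    define e :: complex where "e = (- 1) ^ a"
    have e: "(- 1) ^ a = e" "(- 1) ^ l = e"
      using n a by (simp_all add: e_def l_def minus_one_power_iff)
    define L where "L s = (if a = 0 then 0 else dunkl_coeff (k 2) (Suc l) * f ((a - 1, Suc l, 0), s))" for s
    define U where "U s = (if l = 0 then 0 else dunkl_coeff (k 1) (Suc a) * f ((Suc a, l - 1, 0), s))" for s
    define g where "g = refl_op 1 (refl_op 2 f)"
    have g: "g ((p, q, 0), s) = f ((p, q, 0), s)" if "p + q = n" for p q s
    proof -
      have "(- 1 :: complex) ^ p * (- 1) ^ q = 1"
        using n that by (simp flip: power_add)
      then show ?thesis by (simp add: g_def op_simps flip: mult.assoc)
    qed
    have Lop: "Lop k 2 1 g ((a, l, 0), s) = U s - L s" for s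
    proof -
      have "mulx 2 (dunkl k 1 g) ((a, l, 0), s) = U s"
        using a g[of "Suc a" "l - 1" s] by (auto simp: op_simps U_def l_def)
      moreover have "mulx 1 (dunkl k 2 g) ((a, l, 0), s) = L s"
        using a g[of "a - 1" "Suc l" s] by (auto simp: op_simps L_def l_def)
      ultimately show ?thesis by (simp add: Lop_def vec_apply)
    qed
    have Gop: "Gop k 3 2 1 1 2 f = vadd (vadd (vadd (smul \<i> (pauli_act 3 (Lop k 2 1 g))) (smul (1 / 2) g))
        (smul (of_real (k 1)) (refl_op 2 f))) (smul (of_real (k 2)) (refl_op 1 f))"
      by (simp add: Gop_def Let_def g_def)
    have "g ((a, l, 0), s) = f ((a, l, 0), s)" for s using a by (intro g) (simp add: l_def)
    then have Z: "Gop k 3 2 1 1 2 f ((a, l, 0), 0) = \<i> * (L 0 - U 0) * - 1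
          + (1 / 2 + e * (of_real (k 1) + of_real (k 2))) * f ((a, l, 0), 0)"
      "Gop k 3 2 1 1 2 f ((a, l, 0), 1) = \<i> * (L 1 - U 1)
          + (1 / 2 + e * (of_real (k 1) + of_real (k 2))) * f ((a, l, 0), 1)"
      unfolding Gop by (simp_all add: vec_apply pauli_act_simps refl_op_simps Lop e algebra_simps del: One_nat_def)
    from Z have G: "Gop k 3 2 1 1 2 f ((a, l, 0), side b) = phase b * (L (side b) - U (side b))
          + (1 / 2 + e * (of_real (k 1) + of_real (k 2))) * f ((a, l, 0), side b)"
      by (simp add: side_def phase_def)
    have P: "phase b ^ a * Gop k 3 2 1 1 2 f ((a, l, 0), side b) = phase b ^ Suc a * L (side b) - phase b ^ Suc a * U (side b)
          + (1 / 2 + e * (of_real (k 1) + of_real (k 2))) * (phase b ^ a * f ((a, l, 0), side b))"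
      unfolding G by (simp add: algebra_simps)
    have pp: "phase b * (phase b * x) = - x" for x by (simp add: phase_def flip: mult.assoc)
    have L: "phase b ^ Suc a * L (side b) = - (if a = 0 then 0 else dunkl_coeff (k 2) (Suc n - a) * restr n b f (a - 1))"
      using a by (cases a) (simp_all add: L_def restr_def l_def pp mult.left_commute Suc_diff_Suc Suc_diff_le)
    have U: "phase b ^ Suc a * U (side b) = dunkl_coeff (k 1) (Suc a) * restr n b f (Suc a)"
      using a by (simp add: U_def restr_def l_def)
    show ?thesis using a P unfolding L U by (simp add: restr_def VZ_def e l_def del: One_nat_def)
  qed (simp add: restr_def VZ_def)
qed

section \<open>Solving the Dirac equation in powers of x_3\<close>

lemma tpar_enat:
  assumes "tpar r = enat t"
  shows "odd t" "2 * r = - real t"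
proof -
  from assms obtain j :: nat where j: "odd j" "2 * r = - real j"
    unfolding tpar_def by (metis (lifting) enat.distinct(1))
  then have "tpar r = enat (nat (- \<lfloor>2 * r\<rfloor>))" unfolding tpar_def by auto
  also have "\<lfloor>2 * r\<rfloor> = - int j"
    unfolding j(2) by (metis floor_of_int of_int_minus of_int_of_nat_eq)
  finally have "tpar r = enat j" by simp
  then show "odd t" "2 * r = - real t" using j assms by auto
qed

lemma dunkl_coeff_nonzero:
  assumes "enat n < tpar r" "m \<noteq> 0" "m \<le> n"
  shows "dunkl_coeff r m \<noteq> 0"
proof
  assume 0: "dunkl_coeff r m = 0"
  with assms(2) have odd: "odd m" by (auto simp: dunkl_coeff_def)
  with 0 have "of_real (real m + 2 * r) = (0 :: complex)" by (simp add: dunkl_coeff_def mult.commute)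
  then have "real m + 2 * r = 0" by (simp only: of_real_eq_0_iff)
  then have r: "2 * r = - real m" by simp
  then have "tpar r = enat (nat (- \<lfloor>2 * r\<rfloor>))" using odd unfolding tpar_def by auto
  also have "\<lfloor>2 * r\<rfloor> = - int m"
    unfolding r by (metis floor_of_int of_int_minus of_int_of_nat_eq)
  finally show False using assms by simp
qed

text \<open>The recursion of \<open>Mn_recursion\<close>, started from arbitrary values
  \<open>g\<close> on the plane; \<open>c\<close> is the exponent of x_3.\<close>

primrec extend :: "(nat \<Rightarrow> real) \<Rightarrow> (nat \<Rightarrow> nat \<Rightarrow> nat \<Rightarrow> complex) \<Rightarrow> nat \<Rightarrow> nat \<Rightarrow> nat \<Rightarrow> nat \<Rightarrow> complex" where
  "extend k g 0 = g"
| "extend k g (Suc c) = (\<lambda>a b s.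
     if s = 0 then (- dunkl_coeff (k 1) (Suc a) * extend k g c (Suc a) b 1
         + \<i> * dunkl_coeff (k 2) (Suc b) * extend k g c a (Suc b) 1) / dunkl_coeff (k 3) (Suc c)
     else if s = 1 then (dunkl_coeff (k 1) (Suc a) * extend k g c (Suc a) b 0
         + \<i> * dunkl_coeff (k 2) (Suc b) * extend k g c a (Suc b) 0) / dunkl_coeff (k 3) (Suc c)
     else 0)"

lemma extend_outside:
  assumes "\<And>a b s. a + b \<noteq> n \<or> 2 \<le> s \<Longrightarrow> g a b s = 0"
  shows "a + b + c \<noteq> n \<or> 2 \<le> s \<Longrightarrow> extend k g c a b s = 0"
  by (induction c arbitrary: a b s) (auto simp: assms)

context
  fixes k :: "nat \<Rightarrow> real" and n :: nat
  assumes t3: "enat n < tpar (k 3)"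
begin

lemma restr_onto:
  assumes u: "\<And>b. u b \<in> seqs n"
  shows "\<exists>f\<in>Mn k n. \<forall>b. restr n b f = u b"
proof -
  \<comment> \<open>Division by the power of \<open>phase\<close> cancels the weight in
    \<open>restr\<close>.\<close>
  define g where "g a b s = (if a + b = n \<and> s < 2 then u (s = 0) a / phase (s = 0) ^ a else 0)" for a b s :: nat
  define f where "f = (\<lambda>((a, b, c), s). extend k g c a b s)"
  have f: "f ((a, b, c), s) = extend k g c a b s" for a b c s by (simp add: f_def)
  have out: "f ((a, b, c), s) = 0" if "a + b + c \<noteq> n \<or> 2 \<le> s" for a b c s
    unfolding f by (rule extend_outside[OF _ that]) (auto simp: g_def)
  have rec: "dunkl_coeff (k 3) (Suc c) * f ((a, b, Suc c), 0) =
      - dunkl_coeff (k 1) (Suc a) * f ((Suc a, b, c), 1) + \<i> * dunkl_coeff (k 2) (Suc b) * f ((a, Suc b, c), 1) \<and>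
      dunkl_coeff (k 3) (Suc c) * f ((a, b, Suc c), 1) =
      dunkl_coeff (k 1) (Suc a) * f ((Suc a, b, c), 0) + \<i> * dunkl_coeff (k 2) (Suc b) * f ((a, Suc b, c), 0)" for a b c
  proof (cases "a + b + Suc c = n")
    case True
    then have "dunkl_coeff (k 3) (Suc c) \<noteq> 0" by (intro dunkl_coeff_nonzero[OF t3]) auto
    then show ?thesis by (simp add: f)
  next
    \<comment> \<open>Outside total degree \<open>n\<close> the divisor may be zero, but then every
      coefficient in the equations vanishes.\<close>
    case False
    then show ?thesis by (simp add: out)
  qed
  have "dirac k f ((a, b, c), s) = 0" for a b c s
  proof -
    consider "s = 0" | "s = 1" | "s \<noteq> 0" "s \<noteq> 1" by blast
    then show ?thesis
      using rec[of c a b] by cases (simp_all add: dirac_apply del: One_nat_def)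
  qed
  moreover have "f ((a, b, c), s) \<noteq> 0 \<longrightarrow> a + b + c = n \<and> s < 2" for a b c s
    using out[of a b c s] by linarith
  then have "f \<in> Pn n" by (simp add: Pn_def)
  ultimately have "f \<in> Mn k n" by (simp add: Mn_def fun_eq_iff vec_apply)
  moreover have "restr n b f = u b" for b
  proof
    fix a
    show "restr n b f a = u b a"
      using seqs_outside[OF u, of a b] by (cases b) (auto simp: restr_def f g_def side_def phase_def)
  qed
  ultimately show ?thesis by blast
qed

text \<open>The T_3 coefficients are nonzero up to degree \<open>n\<close>. By the recursion a
  nonzero coefficient at x_3^(c+1) therefore needs one at x_3^c that is linked to it by a nonzero
  T_1 or T_2 coefficient. A property of the exponents that holds on the plane and passes along such
  links holds on the whole support.\<close>

lemma Mn_support: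
  assumes f: "f \<in> Mn k n"
    and base: "\<And>a b s. f ((a, b, 0), s) \<noteq> 0 \<Longrightarrow> G a b"
    and step: "\<And>a b. G (Suc a) b \<Longrightarrow> dunkl_coeff (k 1) (Suc a) \<noteq> 0 \<Longrightarrow> G a b"
      "\<And>a b. G a (Suc b) \<Longrightarrow> dunkl_coeff (k 2) (Suc b) \<noteq> 0 \<Longrightarrow> G a b"
  shows "f ((a, b, c), s) \<noteq> 0 \<Longrightarrow> G a b"
proof (induction c arbitrary: a b s)
  case 0
  then show ?case using base by blast
next
  case (Suc c)
  have P: "f \<in> Pn n" using f by (simp add: Mn_def)
  have s: "a + b + Suc c = n" "s = 0 \<or> s = 1"
    using Pn_outside[OF P, of a b "Suc c" s] Suc.prems by linarith+
  then have "dunkl_coeff (k 3) (Suc c) * f ((a, b, Suc c), s) \<noteq> 0"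
    using Suc.prems dunkl_coeff_nonzero[OF t3, of "Suc c"] by simp
  then have "dunkl_coeff (k 1) (Suc a) * f ((Suc a, b, c), 1 - s) \<noteq> 0 \<or> dunkl_coeff (k 2) (Suc b) * f ((a, Suc b, c), 1 - s) \<noteq> 0"
    (is "?A \<noteq> 0 \<or> ?B \<noteq> 0")
  proof -
    have "dunkl_coeff (k 3) (Suc c) * f ((a, b, Suc c), s) = (if s = 0 then - 1 else 1) * ?A + \<i> * ?B"
      using s(2) Mn_recursion[OF f, of c a b] by (elim disjE) simp_all
    with \<open>dunkl_coeff (k 3) (Suc c) * f ((a, b, Suc c), s) \<noteq> 0\<close> show ?thesis by auto
  qed
  then show ?case
    using Suc.IH[of "Suc a" b "1 - s"] Suc.IH[of a "Suc b" "1 - s"] step[of a b] by (metis mult_eq_0_iff)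
qed

lemma restr_nonzero:
  assumes "f \<in> Mn k n" "f ((a, b, 0), s) \<noteq> 0"
  shows "a + b = n" "restr n (s = 0) f a \<noteq> 0"
proof -
  have "f \<in> Pn n" using assms by (simp add: Mn_def)
  from Pn_outside[OF this, of a b 0 s] assms(2) have *: "a + b = n" "s = 0 \<or> s = 1" by linarith+
  then show "a + b = n" by simp
  from * have "b = n - a" by simp
  with * assms(2) show "restr n (s = 0) f a \<noteq> 0"
    by (auto simp: restr_def side_def phase_def)
qed

text \<open>Uniqueness of the solution: with empty support on the plane, \<open>Mn_support\<close>
  applies to the property that is always false.\<close>

lemma restr_eq_vzero:
  assumes f: "f \<in> Mn k n"
  shows "f = vzero \<longleftrightarrow> (\<forall>b. restr n b f = vzero)"
proof
  assume *: "\<forall>b. restr n b f = vzero"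
  have "f ((a, b, c), s) = 0" for a b c s
    using Mn_support[OF f, of "\<lambda>_ _. False" a b c s] restr_nonzero(2)[OF f] * by (auto simp: vec_apply)
  then show "f = vzero" by (simp add: fun_eq_iff vec_apply)
qed (auto simp: restr_def fun_eq_iff vec_apply)

text \<open>The plane suffices: along the recursion the exponent of x_1 falls by one only with a
  nonzero T_1 coefficient, and at \<open>t1\<close> this coefficient is zero.\<close>

lemma Mx1_iff:
  assumes t1: "tpar (k 1) = enat t1" and f: "f \<in> Mn k n"
  shows "f \<in> Mx k n 1 \<longleftrightarrow> (\<forall>b. restr n b f \<in> seqs_in n (\<lambda>a. t1 \<le> a))"
proof
  assume "f \<in> Mx k n 1"
  then have "f ((a, b, c), s) \<noteq> 0 \<Longrightarrow> t1 \<le> a" for a b c s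
    using t1 unfolding Mx_def by fastforce
  then have "f ((a, b, c), s) = 0" if "\<not> t1 \<le> a" for a b c s using that by blast
  then show "\<forall>b. restr n b f \<in> seqs_in n (\<lambda>a. t1 \<le> a)"
    by (intro allI seqs_inI[OF restr_seqs]) (simp add: restr_def)
next
  assume *: "\<forall>b. restr n b f \<in> seqs_in n (\<lambda>a. t1 \<le> a)"
  have t: "dunkl_coeff (k 1) t1 = 0"
    using arg_cong[OF tpar_enat(2)[OF t1], of complex_of_real] tpar_enat(1)[OF t1] by (simp add: dunkl_coeff_def mult.commute)
  have "t1 \<le> a" if "f ((a, b, c), s) \<noteq> 0" for a b c s
  proof (rule Mn_support[OF f _ _ _ that])
    fix a b s assume "f ((a, b, 0), s) \<noteq> 0"
    from restr_nonzero(2)[OF f this] * show "t1 \<le> a" by (auto simp: seqs_in_def)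
  qed (use t in \<open>auto simp: le_Suc_eq\<close>)
  with f t1 show "f \<in> Mx k n 1" by (auto simp: Mx_def)
qed

lemma Mx2_iff:
  assumes t2: "tpar (k 2) = enat t2" and f: "f \<in> Mn k n"
  shows "f \<in> Mx k n 2 \<longleftrightarrow> (\<forall>b. restr n b f \<in> seqs_in n (\<lambda>a. a + t2 \<le> n))"
proof
  assume "f \<in> Mx k n 2"
  then have "f ((a, b, c), s) \<noteq> 0 \<Longrightarrow> t2 \<le> b" for a b c s
    using t2 unfolding Mx_def by fastforce
  then have "f ((a, b, c), s) = 0" if "\<not> t2 \<le> b" for a b c s using that by blast
  then show "\<forall>b. restr n b f \<in> seqs_in n (\<lambda>a. a + t2 \<le> n)"
    by (intro allI seqs_inI[OF restr_seqs]) (simp add: restr_def)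
next
  assume *: "\<forall>b. restr n b f \<in> seqs_in n (\<lambda>a. a + t2 \<le> n)"
  have t: "dunkl_coeff (k 2) t2 = 0"
    using arg_cong[OF tpar_enat(2)[OF t2], of complex_of_real] tpar_enat(1)[OF t2] by (simp add: dunkl_coeff_def mult.commute)
  have "t2 \<le> b" if "f ((a, b, c), s) \<noteq> 0" for a b c s
  proof (rule Mn_support[OF f _ _ _ that])
    fix a b s assume nz: "f ((a, b, 0), s) \<noteq> 0"
    from restr_nonzero(2)[OF f nz] * have "a + t2 \<le> n" by (auto simp: seqs_in_def)
    with restr_nonzero(1)[OF f nz] show "t2 \<le> b" by simp
  qed (use t in \<open>auto simp: le_Suc_eq\<close>)
  with f t2 show "f \<in> Mx k n 2" by (auto simp: Mx_def)
qed

text \<open>The restrictions of the two coordinates identify \<open>Mn k n\<close> with two copies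
  of the module of initial values, and the quotient map is applied to each copy.\<close>

lemma lift_quot_iso:
  assumes n: "even n" and A: "A \<subseteq> seqs n" and iso: "bimod_quot_iso (V k n) A B W"
  shows "bimod_quot_iso (Mmod k n) {f \<in> Mn k n. \<forall>b. restr n b f \<in> A} {f \<in> Mn k n. \<forall>b. restr n b f \<in> B} (dsum W)"
proof -
  from iso obtain p where BA: "B \<subseteq> A" and p: "linear_on A p" "p ` A = car W" "\<forall>v\<in>A. p v = vzero \<longleftrightarrow> v \<in> B"
    "intertwines (V k n) W A p"
    unfolding bimod_quot_iso_def by blast
  let ?A = "{f \<in> Mn k n. \<forall>b. restr n b f \<in> A}"
  define \<phi> where "\<phi> f = (\<lambda>(b, i). p (restr n b f) i)" for f :: "idx \<Rightarrow> complex"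
  have "linear_on ?A \<phi>"
    using p(1) by (auto simp: linear_on_def \<phi>_def restr_vadd restr_smul fun_eq_iff vec_apply)
  moreover have "\<phi> ` ?A = car (dsum W)"
  proof
    show "\<phi> ` ?A \<subseteq> car (dsum W)" using p(2) by (auto simp: dsum_def \<phi>_def)
    show "car (dsum W) \<subseteq> \<phi> ` ?A"
    proof
      fix w assume "w \<in> car (dsum W)"
      then have "(\<lambda>i. w (b, i)) \<in> p ` A" for b
        unfolding p(2) by (cases b) (auto simp: dsum_def)
      then have "\<exists>u\<in>A. p u = (\<lambda>i. w (b, i))" for b by (metis imageE)
      then obtain u where u: "\<And>b. u b \<in> A" "\<And>b. p (u b) = (\<lambda>i. w (b, i))" by metis
      with A have "u b \<in> seqs n" for b by blast
      with restr_onto[of u] obtain f where f: "f \<in> Mn k n" "\<And>b. restr n b f = u b" by blast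
      then have "\<phi> f = w" "f \<in> ?A" using u by (auto simp: \<phi>_def)
      then show "w \<in> \<phi> ` ?A" by blast
    qed
  qed
  moreover have "\<phi> f = vzero \<longleftrightarrow> f \<in> {f \<in> Mn k n. \<forall>b. restr n b f \<in> B}" if "f \<in> ?A" for f
  proof -
    have "\<phi> f = vzero \<longleftrightarrow> (\<forall>b. p (restr n b f) = vzero)"
      by (auto simp: \<phi>_def fun_eq_iff vec_apply)
    then show ?thesis using that p(3) by auto
  qed
  moreover have "intertwines (Mmod k n) (dsum W) ?A \<phi>"
    using p(4) unfolding intertwines_def
    by (simp add: Mmod_def dsum_def \<phi>_def restr_X[OF n] restr_Y[OF n] restr_Z[OF n] del: One_nat_def)
  ultimately show ?thesis using BA unfolding bimod_quot_iso_def by blast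
qed

end

section \<open>The theorem\<close>

lemma Z_relation_V:
  fixes k :: "nat \<Rightarrow> real"
  assumes "even n" "A \<subseteq> seqs n" "\<And>v. v \<in> A \<Longrightarrow> VX k n v \<in> A" "\<And>v. v \<in> A \<Longrightarrow> VY k n v \<in> A"
  shows "Z_relation (of_real (2 * k 1 * k 2 + 2 * k 3 * (k 1 + k 2 + k 3 + real n + 1))) A (V k n)"
  using assms VZ_eq[of n _ k] by (auto simp: Z_relation_def)

lemma Ophi_of_real_neq_0:
  assumes "1 \<le> i" "i \<le> d"
    and "even i \<Longrightarrow> real d + 1 - 2 * real i - 2 * a - 2 * b - 2 * c \<noteq> 0"
    and "odd i \<Longrightarrow> real d + 1 - 2 * real i - 2 * a - 2 * b + 2 * c \<noteq> 0"
  shows "Ophi d (of_real a) (of_real b) (of_real c) i \<noteq> 0"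
proof -
  have "Ophi d (of_real a) (of_real b) (of_real c) i = of_real (if even i
      then real i * (real d + 1 - 2 * real i - 2 * a - 2 * b - 2 * c) / 2
      else (real i - real d - 1) * (real d + 1 - 2 * real i - 2 * a - 2 * b + 2 * c) / 2)"
    by (simp add: Ophi_def)
  moreover have "real i - real d - 1 \<noteq> 0" using assms(2) by linarith
  ultimately show ?thesis using assms by (simp split: if_splits)
qed

lemma subspace_Mn: "subspace_c (Mn k n)"
proof -
  have "dirac k (vadd f g) = vadd (dirac k f) (dirac k g)" for f g
    by (auto simp: dirac_def pauli_act_def dunkl_def fun_eq_iff vec_apply algebra_simps sum.distrib)
  moreover have "dirac k (smul r f) = smul r (dirac k f)" for r f
    by (auto simp: dirac_def pauli_act_def dunkl_def fun_eq_iff vec_apply algebra_simps sum_distrib_left)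
  moreover have "dirac k vzero = vzero"
    by (auto simp: dirac_def pauli_act_def dunkl_def fun_eq_iff vec_apply)
  moreover have "subspace_c (Pn n)"
    unfolding subspace_c_def Pn_def by (auto simp: vec_apply) (metis add_0)+
  ultimately show ?thesis
    unfolding subspace_c_def Mn_def by (auto simp: fun_eq_iff vec_apply)
qed

lemma subspace_restr:
  assumes "subspace_c A"
  shows "subspace_c {f \<in> Mn k n. \<forall>b. restr n b f \<in> A}"
proof -
  have "restr n b vzero = vzero" for b by (simp add: restr_def fun_eq_iff vec_apply)
  then show ?thesis
    using assms subspace_Mn[of k n] by (auto simp: subspace_c_def restr_vadd restr_smul)
qed

theorem theorem8p13:
  fixes k :: "nat \<Rightarrow> real" and n t1 t2 :: nat
  assumes "even n"
    and "tpar (k 1) = enat t1" and "tpar (k 2) = enat t2"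
    and "t1 + t2 \<le> n" and "enat n < tpar (k 3)"
  defines "M \<equiv> Mmod k n"
    and "W1 \<equiv> twist (sign_aut (-1) 1) swap12
                (Omod (n - t1 - t2) (of_real (k 2 + k 3 + (real n + 1) / 2)) (of_real (- k 1 - k 3 - (real n + 1) / 2)) (of_real (- (real n + 1) / 2)))"
    and "W2 \<equiv> twist (sign_aut 1 (-1)) swap12
                (Omod (t1 - 1) (of_real (k 3)) (of_real (- (k 1 + k 2 + k 3) - real n - 1)) (of_real (- k 2)))"
    and "W3 \<equiv> twist (sign_aut 1 (-1)) id
                (Omod (t2 - 1) (of_real (k 3)) (of_real (- (k 1 + k 2 + k 3) - real n - 1)) (of_real (- k 1)))"
  shows "bimod_iso (M\<lparr>car := Mx k n 1 \<inter> Mx k n 2\<rparr>) (dsum W1)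
       \<and> bimod_quot_iso M (Mx k n 2) (Mx k n 1 \<inter> Mx k n 2) (dsum W2)
       \<and> bimod_quot_iso M (Mn k n) (Mx k n 1) (dsum W2)
       \<and> bimod_quot_iso M (Mx k n 1) (Mx k n 1 \<inter> Mx k n 2) (dsum W3)
       \<and> bimod_quot_iso M (Mn k n) (Mx k n 2) (dsum W3)
       \<and> (k 3 \<ge> 0 \<longrightarrow>
            bimod_irred W1 \<and> bimod_irred W2 \<and> bimod_irred W3
          \<and> bimod_iso W1 (Omod (n - t1 - t2) (of_real (- k 1 - k 3 - (real n + 1) / 2)) (of_real (- k 2 - k 3 - (real n + 1) / 2)) (of_real (real n + 1) / 2))
          \<and> bimod_iso W2 (Omod (t1 - 1) (of_real ((k 1 + k 2 + k 3) + real n + 1)) (of_real (k 3)) (of_real (k 2)))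
          \<and> bimod_iso W3 (Omod (t2 - 1) (of_real (k 3)) (of_real ((k 1 + k 2 + k 3) + real n + 1)) (of_real (k 1))))"
proof -
  note n = assms(1) and tp1 = assms(2) and tp2 = assms(3) and t12 = assms(4) and t3 = assms(5)
  note t1 = tpar_enat[OF tp1] and t2 = tpar_enat[OF tp2]
  define N where "N = (real n + 1) / 2"
  define K where "K = k 1 + k 2 + k 3"
  define d where "d = n - t1 - t2"
  have d: "even d" "n = t1 + t2 + d" using n t1 t2 t12 by (auto simp: d_def)
  have ev: "even (t1 - 1)" "even (t2 - 1)" using t1 t2 by auto
  have pos: "t1 \<ge> 1" "t2 \<ge> 1" using t1 t2 by (auto elim!: oddE)
  have kR: "k 1 = - real t1 / 2" "k 2 = - real t2 / 2" using t1 t2 by auto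
  let ?a = "of_real (k 2 + k 3 + N) :: complex" and ?b = "of_real (- k 1 - k 3 - N) :: complex"
    and ?c = "of_real (- N) :: complex" and ?e = "of_real (- K - real n - 1) :: complex"
  have W: "W1 = twist1 d ?a ?b ?c" "W2 = twist2 (t1 - 1) (of_real (k 3)) ?e (of_real (- k 2))"
    "W3 = twist3 (t2 - 1) (of_real (k 3)) ?e (of_real (- k 1))"
    unfolding W1_def W2_def W3_def twist1_def twist2_def twist3_def d_def N_def K_def
    by (simp_all only: minus_divide_left)
  \<comment> \<open>The scalar of \<open>VZ_eq\<close>. That \<open>W1\<close>, \<open>W2\<close>
    and \<open>W3\<close> share it depends on \<open>k 1 = - t1 / 2\<close> and
    \<open>k 2 = - t2 / 2\<close>, and for \<open>W1\<close> also on
    \<open>d = n - t1 - t2\<close>.\<close>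
  define \<kappa> :: complex where "\<kappa> = of_real (2 * k 1 * k 2 + 2 * k 3 * (K + real n + 1))"
  have ZW: "Z_relation \<kappa> (car W1) W1" "Z_relation \<kappa> (car W2) W2" "Z_relation \<kappa> (car W3) W3"
  proof -
    have "\<kappa> = - (2 * ?a * ?b - ?c * (of_nat d + 1))"
    proof -
      have "2 * k 1 * k 2 + 2 * k 3 * (K + real n + 1) = - (2 * (k 2 + k 3 + N) * (- k 1 - k 3 - N) - - N * (real d + 1))"
        unfolding kR K_def N_def d(2) by (simp add: field_simps)
      from arg_cong[OF this, of complex_of_real] show ?thesis unfolding \<kappa>_def by simp
    qed
    then show "Z_relation \<kappa> (car W1) W1"
      unfolding W using Z_relation_twist(1)[of ?a ?b ?c d] by simp
    have "\<kappa> = - (2 * of_real (k 3) * ?e - of_real (- k 2) * (of_nat (t1 - 1) + 1))"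
    proof -
      have "2 * k 1 * k 2 + 2 * k 3 * (K + real n + 1) = - (2 * k 3 * (- K - real n - 1) - (- k 2) * real t1)"
        unfolding kR(1) by (simp add: algebra_simps)
      from arg_cong[OF this, of complex_of_real] pos show ?thesis unfolding \<kappa>_def by (simp add: of_nat_diff)
    qed
    then show "Z_relation \<kappa> (car W2) W2"
      unfolding W using Z_relation_twist(2)[of "of_real (k 3)" ?e "of_real (- k 2)" "t1 - 1"] by simp
    have "\<kappa> = - (2 * of_real (k 3) * ?e - of_real (- k 1) * (of_nat (t2 - 1) + 1))"
    proof -
      have "2 * k 1 * k 2 + 2 * k 3 * (K + real n + 1) = - (2 * k 3 * (- K - real n - 1) - (- k 1) * real t2)"
        unfolding kR(2) by (simp add: algebra_simps)
      from arg_cong[OF this, of complex_of_real] pos show ?thesis unfolding \<kappa>_def by (simp add: of_nat_diff)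
    qed
    then show "Z_relation \<kappa> (car W3) W3"
      unfolding W using Z_relation_twist(3)[of "of_real (k 3)" ?e "of_real (- k 1)" "t2 - 1"] by simp
  qed
  let ?L = "seqs_in n (\<lambda>a. t1 \<le> a)" and ?U = "seqs_in n (\<lambda>a. a + t2 \<le> n)"
  have dc: "dunkl_coeff (k 1) t1 = 0" "dunkl_coeff (k 2) t2 = 0"
    using dunkl_coeff_eqs[OF n t1(1) t2(1) t12 t1(2) t2(2)] t1(1) t2(1) by auto
  have inv: "v \<in> ?L \<Longrightarrow> VX k n v \<in> ?L" "v \<in> ?L \<Longrightarrow> VY k n v \<in> ?L"
    "v \<in> ?U \<Longrightarrow> VX k n v \<in> ?U" "v \<in> ?U \<Longrightarrow> VY k n v \<in> ?U" for v
    using V_invariant_lower[of k t1 v n] V_invariant_upper[of k t2 v n] dc by blast+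
  have subs: "?L \<subseteq> seqs n" "?U \<subseteq> seqs n" by (auto simp: seqs_in_def)
  \<comment> \<open>By \<open>t1 + t2 \<le> n\<close> the left and right windows are disjoint, so
    each lies in the submodule that cuts off the other.\<close>
  have win: "seqs_in n (\<lambda>a. a < t1) \<subseteq> ?U" "seqs_in n (\<lambda>a. n < a + t2) \<subseteq> ?L"
    "seqs_in n (\<lambda>a. a < t1) \<subseteq> seqs n" "seqs_in n (\<lambda>a. n < a + t2) \<subseteq> seqs n"
    using t12 by (fastforce simp: seqs_in_def)+
  have subsp: "subspace_c ?L" "subspace_c ?U" "subspace_c (?L \<inter> ?U)"
    using subspace_seqs_in[of n] by (auto simp: subspace_c_def)
  note ZV = Z_relation_V[OF n, of _ k, folded K_def, folded \<kappa>_def]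
  have V1: "bimod_quot_iso (V k n) (?L \<inter> ?U) {vzero} W1"
  proof (rule bimod_quot_isoI[OF _ subsp(3) _ ZV ZW(1)])
    show "pair_quot (?L \<inter> ?U) {vzero} (opX (V k n)) (opY (V k n)) (car W1) (opX W1) (opY W1)"
      using window_middle[OF n t1(1) t2(1) t12 t1(2) t2(2)] unfolding W by (simp add: N_def d_def)
  qed (use subs inv subsp(3) in \<open>auto simp: subspace_c_def\<close>)
  have V2: "bimod_quot_iso (V k n) A (A \<inter> ?L) W2"
    if A: "A \<subseteq> seqs n" "seqs_in n (\<lambda>a. a < t1) \<subseteq> A" "subspace_c A"
      "\<And>v. v \<in> A \<Longrightarrow> VX k n v \<in> A" "\<And>v. v \<in> A \<Longrightarrow> VY k n v \<in> A" for A
  proof (rule bimod_quot_isoI[OF _ A(3) _ ZV ZW(2)])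
    show "pair_quot A (A \<inter> ?L) (opX (V k n)) (opY (V k n)) (car W2) (opX W2) (opY W2)"
      using window_left[OF n t1(1) t2(1) t12 t1(2) t2(2) A(1,2,4,5,3)] unfolding W by (simp add: K_def)
  qed (use A in auto)
  have V3: "bimod_quot_iso (V k n) A (A \<inter> ?U) W3"
    if A: "A \<subseteq> seqs n" "seqs_in n (\<lambda>a. n < a + t2) \<subseteq> A" "subspace_c A"
      "\<And>v. v \<in> A \<Longrightarrow> VX k n v \<in> A" "\<And>v. v \<in> A \<Longrightarrow> VY k n v \<in> A" for A
  proof (rule bimod_quot_isoI[OF _ A(3) _ ZV ZW(3)])
    show "pair_quot A (A \<inter> ?U) (opX (V k n)) (opY (V k n)) (car W3) (opX W3) (opY W3)"
      using window_right[OF n t1(1) t2(1) t12 t1(2) t2(2) A(1,2,4,5,3)] unfolding W by (simp add: K_def)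
  qed (use A in auto)
  have Mx: "Mx k n i \<subseteq> Mn k n" for i by (auto simp: Mx_def)
  have M0: "{f \<in> Mn k n. \<forall>b. restr n b f \<in> {vzero}} = {vzero}"
    using restr_eq_vzero[of n k, OF t3] subspace_Mn[of k n] by (auto simp: subspace_c_def)
  have M1: "{f \<in> Mn k n. \<forall>b. restr n b f \<in> ?L} = Mx k n 1"
    using Mx1_iff[of n k, OF t3 tp1] Mx by blast
  have M2: "{f \<in> Mn k n. \<forall>b. restr n b f \<in> ?U} = Mx k n 2"
    using Mx2_iff[of n k, OF t3 tp2] Mx by blast
  have M12: "{f \<in> Mn k n. \<forall>b. restr n b f \<in> ?L \<inter> ?U} = Mx k n 1 \<inter> Mx k n 2"
    unfolding M1[symmetric] M2[symmetric] by blast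
  have Mall: "{f \<in> Mn k n. \<forall>b. restr n b f \<in> seqs n} = Mn k n" by simp
  note lift = lift_quot_iso[of n k, OF t3 n, folded M_def]
  have "bimod_iso (M\<lparr>car := Mx k n 1 \<inter> Mx k n 2\<rparr>) (dsum W1)"
  proof (rule bimod_quot_iso_imp_iso)
    have "?L \<inter> ?U \<subseteq> seqs n" using subs by blast
    from lift[OF this V1] show "bimod_quot_iso M (Mx k n 1 \<inter> Mx k n 2) {vzero} (dsum W1)"
      unfolding M0 M12 .
    show "subspace_c (Mx k n 1 \<inter> Mx k n 2)"
      using subspace_restr[OF subsp(3), of k n] unfolding M12 .
  qed
  moreover have "bimod_quot_iso M (Mx k n 2) (Mx k n 1 \<inter> Mx k n 2) (dsum W2)"
    using lift[OF subs(2) V2[OF subs(2) win(1) subsp(2) inv(3,4)]]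
    unfolding Int_commute[of ?U ?L] M2 M12 .
  moreover have "bimod_quot_iso M (Mn k n) (Mx k n 1) (dsum W2)"
    using lift[OF order_refl V2[OF order_refl win(3) subspace_seqs VX_seqs VY_seqs]]
    unfolding Int_absorb1[OF subs(1)] Mall M1 .
  moreover have "bimod_quot_iso M (Mx k n 1) (Mx k n 1 \<inter> Mx k n 2) (dsum W3)"
    using lift[OF subs(1) V3[OF subs(1) win(2) subsp(1) inv(1,2)]]
    unfolding M1 M12 .
  moreover have "bimod_quot_iso M (Mn k n) (Mx k n 2) (dsum W3)"
    using lift[OF order_refl V3[OF order_refl win(4) subspace_seqs VX_seqs VY_seqs]]
    unfolding Int_absorb1[OF subs(2)] Mall M2 .
  moreover have "bimod_irred W1 \<and> bimod_irred W2 \<and> bimod_irred W3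
          \<and> bimod_iso W1 (Omod (n - t1 - t2) (of_real (- k 1 - k 3 - (real n + 1) / 2)) (of_real (- k 2 - k 3 - (real n + 1) / 2)) (of_real (real n + 1) / 2))
          \<and> bimod_iso W2 (Omod (t1 - 1) (of_real ((k 1 + k 2 + k 3) + real n + 1)) (of_real (k 3)) (of_real (k 2)))
          \<and> bimod_iso W3 (Omod (t2 - 1) (of_real (k 3)) (of_real ((k 1 + k 2 + k 3) + real n + 1)) (of_real (k 1)))"
    if k3: "k 3 \<ge> 0"
  proof -
    have rd: "real n = real t1 + real t2 + real d" using d(2) by simp
    have rpos: "real t1 \<ge> 1" "real t2 \<ge> 1" using pos by simp_all
    \<comment> \<open>For each of the three modules the last factor of \<open>Ophi\<close> keeps its
      sign over the range of \<open>i\<close>, given parity. With the original parameters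
      \<open>k 3\<close> cancels; with the flipped ones it enters as \<open>4 * k 3\<close>, and
      \<open>k 3 \<ge> 0\<close> keeps the factor positive.\<close>
    have \<phi>1: "Ophi d ?a ?b ?c i \<noteq> 0" "Ophi d (- ?a) ?b (- ?c) i \<noteq> 0" if "1 \<le> i" "i \<le> d" for i
    proof -
      have "real i \<ge> 1" "real i \<le> real d" using that by simp_all
      then show "Ophi d ?a ?b ?c i \<noteq> 0" "Ophi d (- ?a) ?b (- ?c) i \<noteq> 0"
        using k3 rd kR rpos unfolding N_def of_real_minus[symmetric]
        by - (rule Ophi_of_real_neq_0[OF that]; simp add: field_simps; linarith?)+
    qed
    have \<phi>2: "Ophi (t1 - 1) (of_real (k 3)) ?e (of_real (- k 2)) i \<noteq> 0"
       "Ophi (t1 - 1) (- of_real (k 3)) ?e (- of_real (- k 2)) i \<noteq> 0" if "1 \<le> i" "i \<le> t1 - 1" for i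
    proof -
      have "real i \<ge> 1" "real i \<le> real t1 - 1" "real (t1 - 1) = real t1 - 1" using that by (simp_all add: of_nat_diff)
      then show "Ophi (t1 - 1) (of_real (k 3)) ?e (of_real (- k 2)) i \<noteq> 0"
         "Ophi (t1 - 1) (- of_real (k 3)) ?e (- of_real (- k 2)) i \<noteq> 0"
        using k3 rd kR rpos unfolding K_def of_real_minus[symmetric]
        by - (rule Ophi_of_real_neq_0[OF that]; simp add: field_simps; linarith?)+
    qed
    have \<phi>3: "Ophi (t2 - 1) (of_real (k 3)) ?e (of_real (- k 1)) i \<noteq> 0"
       "Ophi (t2 - 1) (- of_real (k 3)) ?e (- of_real (- k 1)) i \<noteq> 0" if "1 \<le> i" "i \<le> t2 - 1" for i
    proof -
      have "real i \<ge> 1" "real i \<le> real t2 - 1" "real (t2 - 1) = real t2 - 1" using that by (simp_all add: of_nat_diff)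
      then show "Ophi (t2 - 1) (of_real (k 3)) ?e (of_real (- k 1)) i \<noteq> 0"
         "Ophi (t2 - 1) (- of_real (k 3)) ?e (- of_real (- k 1)) i \<noteq> 0"
        using k3 rd kR rpos unfolding K_def of_real_minus[symmetric]
        by - (rule Ophi_of_real_neq_0[OF that]; simp add: field_simps; linarith?)+
    qed
    have T: "Omod (n - t1 - t2) (of_real (- k 1 - k 3 - (real n + 1) / 2)) (of_real (- k 2 - k 3 - (real n + 1) / 2)) (of_real (real n + 1) / 2)
        = Omod d ?b (- ?a) (- ?c)"
      "Omod (t1 - 1) (of_real ((k 1 + k 2 + k 3) + real n + 1)) (of_real (k 3)) (of_real (k 2))
        = Omod (t1 - 1) (- ?e) (of_real (k 3)) (- of_real (- k 2))"
      "Omod (t2 - 1) (of_real (k 3)) (of_real ((k 1 + k 2 + k 3) + real n + 1)) (of_real (k 1))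
        = Omod (t2 - 1) (of_real (k 3)) (- ?e) (- of_real (- k 1))"
      by (simp_all add: d_def N_def K_def algebra_simps)
    show ?thesis
      unfolding W T
      using twist_irred(1)[OF d(1) \<phi>1] twist_irred(2)[OF ev(1) \<phi>2] twist_irred(3)[OF ev(2) \<phi>3]
        twist1_iso[OF d(1) \<phi>1] twist2_iso[OF ev(1) \<phi>2] twist3_iso[OF ev(2) \<phi>3]
      by blast
  qed
  ultimately show ?thesis by blast
qed

end
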